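(* Let $H$ be a quasi-Hopf algebra over a field $k$, $A$ a left $H$-module algebra, $B=A\#H$ the smash product with its right $H$-comodule algebra structure $\rho(b)=b_{(0)}\otimes b_{(1)}$, and $j:H\to A\#H$, $j(h)=1_A\#h$. Let $E:B\to B$, $E(b)=j(q^1)\,b_{(0)}\,j(\beta S(q^2b_{(1)}))$, where $q^1\otimes q^2=X^1\otimes S^{-1}(\alpha X^3)X^2$, let $B^{co(H)}=E(B)$, and for $b,b'\in B^{co(H)}$, $h\in H$ put $b*b'=E(bb')$ and $h\triangleright b=E(j(h)b)$. Then $E(a\#h)=\varepsilon(h)(a\#1)$ for all $a\in A$, $h\in H$, so $B^{co(H)}=A\#1$, and $$(a\#1)*(a'\#1)=aa'\#1,\qquad h\triangleright(a\#1)=h\cdot a\#1\qquad\text{for all }a,a'\in A,\ h\in H;$$ that is, $B^{co(H)}\simeq A$ as left $H$-module algebras, where $B^{co(H)}$ has multiplication $*$ and $H$-action $\triangleright$.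
   Context: Everything is over a field $k$; $\otimes=\otimes_k$. Quasi-bialgebra: $(H,\Delta,\varepsilon,\Phi)$ with $H$ an associative unital algebra, $\Phi\in H\otimes H\otimes H$ invertible, $\Delta:H\to H\otimes H$ and $\varepsilon:H\to k$ algebra homomorphisms such that for all $h\in H$: $(id\otimes\Delta)(\Delta(h))=\Phi(\Delta\otimes id)(\Delta(h))\Phi^{-1}$; $(id\otimes\varepsilon)(\Delta(h))=h$ and $(\varepsilon\otimes id)(\Delta(h))=h$ (identifying $H\otimes k=k\otimes H=H$); $(1\otimes\Phi)(id\otimes\Delta\otimes id)(\Phi)(\Phi\otimes1)=(id\otimes id\otimes\Delta)(\Phi)(\Delta\otimes id\otimes id)(\Phi)$; $(id\otimes\varepsilon\otimes id)(\Phi)=1\otimes1\otimes 1$ (identified with $1\otimes 1$). Notation (summation understood): $\Delta(h)=h_1\otimes h_2$, $\Phi=X^1\otimes X^2\otimes X^3$, $\Phi^{-1}=x^1\otimes x^2\otimes x^3$. Quasi-Hopf algebra: a quasi-bialgebra $H$ with an anti-automorphism $S$ of the algebra $H$ (in particular $S$ is bijective) and elements $\alpha,\beta\in H$ such that for all $h$: $S(h_1)\alpha h_2=\varepsilon(h)\alpha$, $h_1\beta S(h_2)=\varepsilon(h)\beta$, $X^1\beta S(X^2)\alpha X^3=1$, $S(x^1)\alpha x^2\beta S(x^3)=1$. Left $H$-module algebra: a left $H$-module $A$ (action $h\cdot a$) with a bilinear multiplication and a two-sided unit $1_A$ such that $(aa')a''=(X^1\cdot a)[(X^2\cdot a')(X^3\cdot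 a'')]$, $h\cdot(aa')=(h_1\cdot a)(h_2\cdot a')$, $h\cdot1_A=\varepsilon(h)1_A$ for all $a,a',a''\in A$, $h\in H$. A morphism of left $H$-module algebras is a multiplicative, unital, left $H$-linear map. Smash product $A\#H$: the vector space $A\otimes H$ (elements written $a\#h$) with multiplication $(a\#h)(a'\#h')=(x^1\cdot a)(x^2h_1\cdot a')\#x^3h_2h'$; it is an associative algebra with unit $1_A\#1$. Its right $H$-comodule algebra structure is given by the algebra map $\rho:A\#H\to(A\#H)\otimes H$, $\rho(a\#h)=(x^1\cdot a\#x^2h_1)\otimes x^3h_2$, and $\Phi_\rho=(1_A\#X^1)\otimes X^2\otimes X^3$. *)

theory Defs
  imports "HOL-Algebra.Module" "HOL-Algebra.AbelCoset"
begin

section \<open>Tensor products of modules\<close>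

text \<open>
  The tensor product of \<open>M\<close> and \<open>N\<close> over \<open>K\<close> is the free \<open>K\<close>-module on
  \<open>carrier M \<times> carrier N\<close> modulo the submodule generated by the bilinearity relations;
  its elements are cosets of that submodule.
\<close>

type_synonym ('k, 'a, 'b) tens = "('a \<times> 'b \<Rightarrow> 'k) set"
type_synonym ('k, 'a, 'b, 'c) tens3 = "('k, 'a, ('k, 'b, 'c) tens) tens"

definition free_module :: "('k, 'm) ring_scheme \<Rightarrow> 'x set \<Rightarrow> ('k, 'x \<Rightarrow> 'k) module" where
  "free_module K X =
    \<lparr> carrier = {f. f \<in> X \<rightarrow> carrier K \<and> (\<forall>x. x \<notin> X \<longrightarrow> f x = \<zero>\<^bsub>K\<^esub>) \<and> finite {x. f x \<noteq> \<zero>\<^bsub>K\<^esub>}},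
      mult = undefined,
      one = undefined,
      zero = (\<lambda>_. \<zero>\<^bsub>K\<^esub>),
      add = (\<lambda>f g x. f x \<oplus>\<^bsub>K\<^esub> g x),
      smult = (\<lambda>c f x. c \<otimes>\<^bsub>K\<^esub> f x) \<rparr>"

definition free_gen :: "('k, 'm) ring_scheme \<Rightarrow> 'x \<Rightarrow> 'x \<Rightarrow> 'k" where
  "free_gen K x = (\<lambda>y. if y = x then \<one>\<^bsub>K\<^esub> else \<zero>\<^bsub>K\<^esub>)"

abbreviation tensor_free ::
  "('k, 'm) ring_scheme \<Rightarrow> ('k, 'a, 'p) module_scheme \<Rightarrow> ('k, 'b, 'q) module_scheme
    \<Rightarrow> ('k, 'a \<times> 'b \<Rightarrow> 'k) module" where
  "tensor_free K M N \<equiv> free_module K (carrier M \<times> carrier N)"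

inductive_set tensor_rels ::
  "('k, 'm) ring_scheme \<Rightarrow> ('k, 'a, 'p) module_scheme \<Rightarrow> ('k, 'b, 'q) module_scheme
    \<Rightarrow> ('a \<times> 'b \<Rightarrow> 'k) set"
  for K :: "('k, 'm) ring_scheme" and M :: "('k, 'a, 'p) module_scheme"
    and N :: "('k, 'b, 'q) module_scheme" where
  add_left: "\<lbrakk>x \<in> carrier M; y \<in> carrier M; z \<in> carrier N\<rbrakk> \<Longrightarrow>
    free_gen K (x \<oplus>\<^bsub>M\<^esub> y, z)
      \<ominus>\<^bsub>tensor_free K M N\<^esub> (free_gen K (x, z) \<oplus>\<^bsub>tensor_free K M N\<^esub> free_gen K (y, z))
    \<in> tensor_rels K M N"
| add_right: "\<lbrakk>x \<in> carrier M; y \<in> carrier N; z \<in> carrier N\<rbrakk> \<Longrightarrow>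
    free_gen K (x, y \<oplus>\<^bsub>N\<^esub> z)
      \<ominus>\<^bsub>tensor_free K M N\<^esub> (free_gen K (x, y) \<oplus>\<^bsub>tensor_free K M N\<^esub> free_gen K (x, z))
    \<in> tensor_rels K M N"
| smult_left: "\<lbrakk>c \<in> carrier K; x \<in> carrier M; y \<in> carrier N\<rbrakk> \<Longrightarrow>
    free_gen K (c \<odot>\<^bsub>M\<^esub> x, y)
      \<ominus>\<^bsub>tensor_free K M N\<^esub> (c \<odot>\<^bsub>tensor_free K M N\<^esub> free_gen K (x, y))
    \<in> tensor_rels K M N"
| smult_right: "\<lbrakk>c \<in> carrier K; x \<in> carrier M; y \<in> carrier N\<rbrakk> \<Longrightarrow>
    free_gen K (x, c \<odot>\<^bsub>N\<^esub> y)
      \<ominus>\<^bsub>tensor_free K M N\<^esub> (c \<odot>\<^bsub>tensor_free K M N\<^esub> free_gen K (x, y))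
    \<in> tensor_rels K M N"

definition tensor_null ::
  "('k, 'm) ring_scheme \<Rightarrow> ('k, 'a, 'p) module_scheme \<Rightarrow> ('k, 'b, 'q) module_scheme
    \<Rightarrow> ('k, 'a, 'b) tens" where
  "tensor_null K M N = \<Inter> {U. submodule U K (tensor_free K M N) \<and> tensor_rels K M N \<subseteq> U}"

definition tpure ::
  "('k, 'm) ring_scheme \<Rightarrow> ('k, 'a, 'p) module_scheme \<Rightarrow> ('k, 'b, 'q) module_scheme
    \<Rightarrow> 'a \<Rightarrow> 'b \<Rightarrow> ('k, 'a, 'b) tens" where
  "tpure K M N x y = tensor_null K M N +>\<^bsub>tensor_free K M N\<^esub> free_gen K (x, y)"

text \<open>
  \<open>tsum K P t F\<close> is the Sweedler sum \<open>\<Sum> F t\<^sub>1 t\<^sub>2\<close> in \<open>P\<close>, i.e. the value at \<open>t\<close> of the linear map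
  \<open>M \<otimes> N \<rightarrow> P\<close> induced by the bilinear map \<open>F\<close>.  It is computed on a representative of \<open>t\<close>;
  when \<open>F\<close> is bilinear the result does not depend on the choice.
\<close>

definition tsum ::
  "('k, 'm) ring_scheme \<Rightarrow> ('k, 'p, 'r) module_scheme \<Rightarrow> ('k, 'a, 'b) tens
    \<Rightarrow> ('a \<Rightarrow> 'b \<Rightarrow> 'p) \<Rightarrow> 'p" where
  "tsum K P t F =
    (let f = (SOME f. f \<in> t) in
      finsum P (\<lambda>(x, y). f (x, y) \<odot>\<^bsub>P\<^esub> F x y) {xy. f xy \<noteq> \<zero>\<^bsub>K\<^esub>})"

definition tsum3 ::
  "('k, 'm) ring_scheme \<Rightarrow> ('k, 'p, 'r) module_scheme \<Rightarrow> ('k, 'a, 'b, 'c) tens3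
    \<Rightarrow> ('a \<Rightarrow> 'b \<Rightarrow> 'c \<Rightarrow> 'p) \<Rightarrow> 'p" where
  "tsum3 K P t F = tsum K P t (\<lambda>x u. tsum K P u (\<lambda>y z. F x y z))"

definition tensor_module ::
  "('k, 'm) ring_scheme \<Rightarrow> ('k, 'a, 'p) module_scheme \<Rightarrow> ('k, 'b, 'q) module_scheme
    \<Rightarrow> ('k, ('k, 'a, 'b) tens) module" where
  "tensor_module K M N =
    \<lparr> carrier = a_rcosets\<^bsub>tensor_free K M N\<^esub> (tensor_null K M N),
      mult = undefined,
      one = undefined,
      zero = tensor_null K M N,
      add = set_add (tensor_free K M N),
      smult = (\<lambda>c t. tensor_null K M N <+>\<^bsub>tensor_free K M N\<^esub> ((\<lambda>f. c \<odot>\<^bsub>tensor_free K M N\<^esub> f) ` t)) \<rparr>"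

text \<open>The tensor product with the componentwise multiplication \<open>(x \<otimes> y)(x' \<otimes> y') = xx' \<otimes> yy'\<close>.\<close>

definition tensor ::
  "('k, 'm) ring_scheme \<Rightarrow> ('k, 'a, 'p) module_scheme \<Rightarrow> ('k, 'b, 'q) module_scheme
    \<Rightarrow> ('k, ('k, 'a, 'b) tens) module" where
  "tensor K M N = (tensor_module K M N)
    \<lparr> mult := (\<lambda>t u. tsum K (tensor_module K M N) t (\<lambda>x y. tsum K (tensor_module K M N) u (\<lambda>x' y'.
        tpure K M N (x \<otimes>\<^bsub>M\<^esub> x') (y \<otimes>\<^bsub>N\<^esub> y')))),
      one := tpure K M N \<one>\<^bsub>M\<^esub> \<one>\<^bsub>N\<^esub> \<rparr>"

text \<open>Tensor powers are bracketed to the right, e.g. \<open>H \<otimes> (H \<otimes> (H \<otimes> H))\<close>.\<close>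

abbreviation "tensor2 K H \<equiv> tensor K H H"
abbreviation "tensor3 K H \<equiv> tensor K H (tensor2 K H)"
abbreviation "tensor4 K H \<equiv> tensor K H (tensor3 K H)"
abbreviation "pure2 K H x y \<equiv> tpure K H H x y"
abbreviation "pure3 K H x y z \<equiv> tpure K H (tensor2 K H) x (pure2 K H y z)"
abbreviation "pure4 K H x y z w \<equiv> tpure K H (tensor3 K H) x (pure3 K H y z w)"


section \<open>Algebras and quasi-Hopf algebras\<close>

definition lin_hom ::
  "('k, 'm) ring_scheme \<Rightarrow> ('k, 'a, 'p) module_scheme \<Rightarrow> ('k, 'b, 'q) module_scheme
    \<Rightarrow> ('a \<Rightarrow> 'b) set" where
  "lin_hom K M N = {f. f \<in> carrier M \<rightarrow> carrier N \<and>
    (\<forall>x \<in> carrier M. \<forall>y \<in> carrier M. f (x \<oplus>\<^bsub>M\<^esub> y) = f x \<oplus>\<^bsub>N\<^esub> f y) \<and>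
    (\<forall>c \<in> carrier K. \<forall>x \<in> carrier M. f (c \<odot>\<^bsub>M\<^esub> x) = c \<odot>\<^bsub>N\<^esub> f x)}"

text \<open>The library locale \<open>algebra\<close> is restricted to commutative algebras.\<close>

locale assoc_algebra = K: field K + module K H + ring H
  for K :: "('k, 'm) ring_scheme" and H :: "('k, 'h, 'p) module_scheme" (structure) +
  assumes smult_mult_left: "\<lbrakk>c \<in> carrier K; x \<in> carrier H; y \<in> carrier H\<rbrakk> \<Longrightarrow>
      (c \<odot> x) \<otimes> y = c \<odot> (x \<otimes> y)"
    and smult_mult_right: "\<lbrakk>c \<in> carrier K; x \<in> carrier H; y \<in> carrier H\<rbrakk> \<Longrightarrow>
      x \<otimes> (c \<odot> y) = c \<odot> (x \<otimes> y)"

record ('k, 'h) quasi_bialgebra = "('k, 'h) module" +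
  comul :: "'h \<Rightarrow> ('k, 'h, 'h) tens"
  counit :: "'h \<Rightarrow> 'k"
  reassoc :: "('k, 'h, 'h, 'h) tens3"

definition reassoc_inv ::
  "('k, 'm) ring_scheme \<Rightarrow> ('k, 'h, 'p) quasi_bialgebra_scheme \<Rightarrow> ('k, 'h, 'h, 'h) tens3" where
  "reassoc_inv K H = inv\<^bsub>tensor3 K H\<^esub> (reassoc H)"

locale quasi_bialgebra = assoc_algebra K H
  for K :: "('k, 'm) ring_scheme" and H :: "('k, 'h, 'p) quasi_bialgebra_scheme" (structure) +
  assumes comul_linear: "comul H \<in> lin_hom K H (tensor2 K H)"
    and comul_ring_hom: "comul H \<in> ring_hom H (tensor2 K H)"
    and counit_ring_hom: "counit H \<in> ring_hom H K"
    and counit_smult: "\<lbrakk>c \<in> carrier K; h \<in> carrier H\<rbrakk> \<Longrightarrow>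
      counit H (c \<odot> h) = c \<otimes>\<^bsub>K\<^esub> counit H h"
    and reassoc_unit: "reassoc H \<in> Units (tensor3 K H)"
    and quasi_coassoc: "h \<in> carrier H \<Longrightarrow>
      tsum K (tensor3 K H) (comul H h) (\<lambda>h1 h2. tpure K H (tensor2 K H) h1 (comul H h2)) =
      reassoc H
        \<otimes>\<^bsub>tensor3 K H\<^esub> tsum K (tensor3 K H) (comul H h) (\<lambda>h1 h2.
            tsum K (tensor3 K H) (comul H h1) (\<lambda>h11 h12. pure3 K H h11 h12 h2))
        \<otimes>\<^bsub>tensor3 K H\<^esub> reassoc_inv K H"
    and counit_right: "h \<in> carrier H \<Longrightarrow>
      tsum K H (comul H h) (\<lambda>h1 h2. counit H h2 \<odot> h1) = h"
    and counit_left: "h \<in> carrier H \<Longrightarrow>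
      tsum K H (comul H h) (\<lambda>h1 h2. counit H h1 \<odot> h2) = h"
    and pentagon:
      "tpure K H (tensor3 K H) \<one> (reassoc H)
        \<otimes>\<^bsub>tensor4 K H\<^esub> tsum3 K (tensor4 K H) (reassoc H) (\<lambda>X1 X2 X3.
            tsum K (tensor4 K H) (comul H X2) (\<lambda>Y1 Y2. pure4 K H X1 Y1 Y2 X3))
        \<otimes>\<^bsub>tensor4 K H\<^esub> tsum3 K (tensor4 K H) (reassoc H) (\<lambda>X1 X2 X3. pure4 K H X1 X2 X3 \<one>)
      = tsum3 K (tensor4 K H) (reassoc H) (\<lambda>X1 X2 X3.
            tpure K H (tensor3 K H) X1 (tpure K H (tensor2 K H) X2 (comul H X3)))
        \<otimes>\<^bsub>tensor4 K H\<^esub> tsum3 K (tensor4 K H) (reassoc H) (\<lambda>X1 X2 X3.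
            tsum K (tensor4 K H) (comul H X1) (\<lambda>Y1 Y2. pure4 K H Y1 Y2 X2 X3))"
    and reassoc_counit:
      "tsum3 K (tensor2 K H) (reassoc H) (\<lambda>X1 X2 X3. pure2 K H X1 (counit H X2 \<odot> X3))
      = \<one>\<^bsub>tensor2 K H\<^esub>"

record ('k, 'h) quasi_hopf = "('k, 'h) quasi_bialgebra" +
  antipode :: "'h \<Rightarrow> 'h"
  alpha :: 'h
  beta :: 'h

locale quasi_hopf_algebra = quasi_bialgebra K H
  for K :: "('k, 'm) ring_scheme" and H :: "('k, 'h, 'p) quasi_hopf_scheme" (structure) +
  assumes antipode_bij: "bij_betw (antipode H) (carrier H) (carrier H)"
    and antipode_linear: "antipode H \<in> lin_hom K H H"
    and antipode_mult: "\<lbrakk>x \<in> carrier H; y \<in> carrier H\<rbrakk> \<Longrightarrow>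
      antipode H (x \<otimes> y) = antipode H y \<otimes> antipode H x"
    and antipode_one: "antipode H \<one> = \<one>"
    and alpha_closed: "alpha H \<in> carrier H"
    and beta_closed: "beta H \<in> carrier H"
    and antipode_alpha: "h \<in> carrier H \<Longrightarrow>
      tsum K H (comul H h) (\<lambda>h1 h2. antipode H h1 \<otimes> alpha H \<otimes> h2) = counit H h \<odot> alpha H"
    and antipode_beta: "h \<in> carrier H \<Longrightarrow>
      tsum K H (comul H h) (\<lambda>h1 h2. h1 \<otimes> beta H \<otimes> antipode H h2) = counit H h \<odot> beta H"
    and reassoc_antipode:
      "tsum3 K H (reassoc H) (\<lambda>X1 X2 X3. X1 \<otimes> beta H \<otimes> antipode H X2 \<otimes> alpha H \<otimes> X3) = \<one>"
    and reassoc_inv_antipode: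
      "tsum3 K H (reassoc_inv K H)
        (\<lambda>x1 x2 x3. antipode H x1 \<otimes> alpha H \<otimes> x2 \<otimes> beta H \<otimes> antipode H x3) = \<one>"


section \<open>Left module algebras\<close>

record ('k, 'h, 'a) module_algebra = "('k, 'a) module" +
  act :: "'h \<Rightarrow> 'a \<Rightarrow> 'a"  (infixr \<open>\<cdot>\<index>\<close> 75)

locale left_module_algebra = H: quasi_bialgebra K H + module K A
  for K :: "('k, 'm) ring_scheme" and H :: "('k, 'h, 'p) quasi_bialgebra_scheme"
    and A :: "('k, 'h, 'a, 'q) module_algebra_scheme" (structure) +
  assumes act_closed: "\<lbrakk>h \<in> carrier H; a \<in> carrier A\<rbrakk> \<Longrightarrow> h \<cdot> a \<in> carrier A"
    and act_add_left: "\<lbrakk>h \<in> carrier H; g \<in> carrier H; a \<in> carrier A\<rbrakk> \<Longrightarrow>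
      (h \<oplus>\<^bsub>H\<^esub> g) \<cdot> a = h \<cdot> a \<oplus> g \<cdot> a"
    and act_add_right: "\<lbrakk>h \<in> carrier H; a \<in> carrier A; a' \<in> carrier A\<rbrakk> \<Longrightarrow>
      h \<cdot> (a \<oplus> a') = h \<cdot> a \<oplus> h \<cdot> a'"
    and act_smult_left: "\<lbrakk>c \<in> carrier K; h \<in> carrier H; a \<in> carrier A\<rbrakk> \<Longrightarrow>
      (c \<odot>\<^bsub>H\<^esub> h) \<cdot> a = c \<odot> (h \<cdot> a)"
    and act_smult_right: "\<lbrakk>c \<in> carrier K; h \<in> carrier H; a \<in> carrier A\<rbrakk> \<Longrightarrow>
      h \<cdot> (c \<odot> a) = c \<odot> (h \<cdot> a)"
    and act_mult: "\<lbrakk>h \<in> carrier H; g \<in> carrier H; a \<in> carrier A\<rbrakk> \<Longrightarrow>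
      (h \<otimes>\<^bsub>H\<^esub> g) \<cdot> a = h \<cdot> (g \<cdot> a)"
    and act_one: "a \<in> carrier A \<Longrightarrow> \<one>\<^bsub>H\<^esub> \<cdot> a = a"
    and mult_closed: "\<lbrakk>a \<in> carrier A; a' \<in> carrier A\<rbrakk> \<Longrightarrow> a \<otimes> a' \<in> carrier A"
    and mult_add_left: "\<lbrakk>a \<in> carrier A; a' \<in> carrier A; a'' \<in> carrier A\<rbrakk> \<Longrightarrow>
      (a \<oplus> a') \<otimes> a'' = a \<otimes> a'' \<oplus> a' \<otimes> a''"
    and mult_add_right: "\<lbrakk>a \<in> carrier A; a' \<in> carrier A; a'' \<in> carrier A\<rbrakk> \<Longrightarrow>
      a \<otimes> (a' \<oplus> a'') = a \<otimes> a' \<oplus> a \<otimes> a''"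
    and mult_smult_left: "\<lbrakk>c \<in> carrier K; a \<in> carrier A; a' \<in> carrier A\<rbrakk> \<Longrightarrow>
      (c \<odot> a) \<otimes> a' = c \<odot> (a \<otimes> a')"
    and mult_smult_right: "\<lbrakk>c \<in> carrier K; a \<in> carrier A; a' \<in> carrier A\<rbrakk> \<Longrightarrow>
      a \<otimes> (c \<odot> a') = c \<odot> (a \<otimes> a')"
    and unit_closed: "\<one> \<in> carrier A"
    and unit_left: "a \<in> carrier A \<Longrightarrow> \<one> \<otimes> a = a"
    and unit_right: "a \<in> carrier A \<Longrightarrow> a \<otimes> \<one> = a"
    and mult_quasi_assoc: "\<lbrakk>a \<in> carrier A; a' \<in> carrier A; a'' \<in> carrier A\<rbrakk> \<Longrightarrow>
      (a \<otimes> a') \<otimes> a'' = tsum3 K A (reassoc H) (\<lambda>X1 X2 X3. (X1 \<cdot> a) \<otimes> ((X2 \<cdot> a') \<otimes> (X3 \<cdot> a'')))"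
    and act_on_mult: "\<lbrakk>h \<in> carrier H; a \<in> carrier A; a' \<in> carrier A\<rbrakk> \<Longrightarrow>
      h \<cdot> (a \<otimes> a') = tsum K A (comul H h) (\<lambda>h1 h2. (h1 \<cdot> a) \<otimes> (h2 \<cdot> a'))"
    and act_on_one: "h \<in> carrier H \<Longrightarrow> h \<cdot> \<one> = counit H h \<odot> \<one>"

definition module_algebra_hom ::
  "('k, 'm) ring_scheme \<Rightarrow> ('k, 'h, 'p) quasi_bialgebra_scheme
    \<Rightarrow> ('k, 'h, 'a, 'q) module_algebra_scheme \<Rightarrow> ('k, 'h, 'b, 'r) module_algebra_scheme
    \<Rightarrow> ('a \<Rightarrow> 'b) set" where
  "module_algebra_hom K H A A' = {f \<in> lin_hom K A A'.
    (\<forall>a \<in> carrier A. \<forall>b \<in> carrier A. f (a \<otimes>\<^bsub>A\<^esub> b) = f a \<otimes>\<^bsub>A'\<^esub> f b) \<and>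
    f \<one>\<^bsub>A\<^esub> = \<one>\<^bsub>A'\<^esub> \<and>
    (\<forall>h \<in> carrier H. \<forall>a \<in> carrier A. f (h \<cdot>\<^bsub>A\<^esub> a) = h \<cdot>\<^bsub>A'\<^esub> f a)}"

definition module_algebra_iso ::
  "('k, 'm) ring_scheme \<Rightarrow> ('k, 'h, 'p) quasi_bialgebra_scheme
    \<Rightarrow> ('k, 'h, 'a, 'q) module_algebra_scheme \<Rightarrow> ('k, 'h, 'b, 'r) module_algebra_scheme
    \<Rightarrow> ('a \<Rightarrow> 'b) set" where
  "module_algebra_iso K H A A' =
    {f \<in> module_algebra_hom K H A A'. bij_betw f (carrier A) (carrier A')}"


section \<open>The smash product and its coinvariants\<close>

definition smash ::
  "('k, 'm) ring_scheme \<Rightarrow> ('k, 'h, 'p) quasi_bialgebra_scheme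
    \<Rightarrow> ('k, 'h, 'a, 'q) module_algebra_scheme \<Rightarrow> ('k, ('k, 'a, 'h) tens) module" where
  "smash K H A = (tensor_module K A H)
    \<lparr> mult := (\<lambda>b b'.
        tsum K (tensor_module K A H) b (\<lambda>a h.
        tsum K (tensor_module K A H) b' (\<lambda>a' h'.
        tsum3 K (tensor_module K A H) (reassoc_inv K H) (\<lambda>x1 x2 x3.
        tsum K (tensor_module K A H) (comul H h) (\<lambda>h1 h2.
          tpure K A H ((x1 \<cdot>\<^bsub>A\<^esub> a) \<otimes>\<^bsub>A\<^esub> ((x2 \<otimes>\<^bsub>H\<^esub> h1) \<cdot>\<^bsub>A\<^esub> a')) (x3 \<otimes>\<^bsub>H\<^esub> h2 \<otimes>\<^bsub>H\<^esub> h')))))),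
      one := tpure K A H \<one>\<^bsub>A\<^esub> \<one>\<^bsub>H\<^esub> \<rparr>"

definition smash_coaction ::
  "('k, 'm) ring_scheme \<Rightarrow> ('k, 'h, 'p) quasi_bialgebra_scheme
    \<Rightarrow> ('k, 'h, 'a, 'q) module_algebra_scheme
    \<Rightarrow> ('k, 'a, 'h) tens \<Rightarrow> ('k, ('k, 'a, 'h) tens, 'h) tens" where
  "smash_coaction K H A b =
    (let BH = tensor K (smash K H A) H in
      tsum K BH b (\<lambda>a h.
      tsum3 K BH (reassoc_inv K H) (\<lambda>x1 x2 x3.
      tsum K BH (comul H h) (\<lambda>h1 h2.
        tpure K (smash K H A) H (tpure K A H (x1 \<cdot>\<^bsub>A\<^esub> a) (x2 \<otimes>\<^bsub>H\<^esub> h1)) (x3 \<otimes>\<^bsub>H\<^esub> h2)))))"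

definition smash_j ::
  "('k, 'm) ring_scheme \<Rightarrow> ('k, 'h, 'p) quasi_bialgebra_scheme
    \<Rightarrow> ('k, 'h, 'a, 'q) module_algebra_scheme \<Rightarrow> 'h \<Rightarrow> ('k, 'a, 'h) tens" where
  "smash_j K H A h = tpure K A H \<one>\<^bsub>A\<^esub> h"

definition q_elem ::
  "('k, 'm) ring_scheme \<Rightarrow> ('k, 'h, 'p) quasi_hopf_scheme \<Rightarrow> ('k, 'h, 'h) tens" where
  "q_elem K H = tsum3 K (tensor2 K H) (reassoc H) (\<lambda>X1 X2 X3.
    pure2 K H X1 (inv_into (carrier H) (antipode H) (alpha H \<otimes>\<^bsub>H\<^esub> X3) \<otimes>\<^bsub>H\<^esub> X2))"

definition smash_E ::
  "('k, 'm) ring_scheme \<Rightarrow> ('k, 'h, 'p) quasi_hopf_scheme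
    \<Rightarrow> ('k, 'h, 'a, 'q) module_algebra_scheme \<Rightarrow> ('k, 'a, 'h) tens \<Rightarrow> ('k, 'a, 'h) tens" where
  "smash_E K H A b =
    (let B = smash K H A; j = smash_j K H A in
      tsum K B (q_elem K H) (\<lambda>q1 q2.
      tsum K B (smash_coaction K H A b) (\<lambda>b0 b1.
        j q1 \<otimes>\<^bsub>B\<^esub> b0 \<otimes>\<^bsub>B\<^esub> j (beta H \<otimes>\<^bsub>H\<^esub> antipode H (q2 \<otimes>\<^bsub>H\<^esub> b1)))))"

text \<open>
  \<open>B\<^sup>c\<^sup>o\<^sup>(\<^sup>H\<^sup>)\<close> for \<open>B = A # H\<close>, with the vector space structure of \<open>B\<close>, the multiplication
  \<open>b * b' = E(bb')\<close>, the unit of \<open>B\<close> and the action \<open>h \<triangleright> b = E(j(h) b)\<close>.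
\<close>

definition smash_coinv ::
  "('k, 'm) ring_scheme \<Rightarrow> ('k, 'h, 'p) quasi_hopf_scheme
    \<Rightarrow> ('k, 'h, 'a, 'q) module_algebra_scheme
    \<Rightarrow> ('k, 'h, ('k, 'a, 'h) tens) module_algebra" where
  "smash_coinv K H A =
    (let B = smash K H A in
    \<lparr> carrier = smash_E K H A ` carrier B,
      mult = (\<lambda>b b'. smash_E K H A (b \<otimes>\<^bsub>B\<^esub> b')),
      one = \<one>\<^bsub>B\<^esub>,
      zero = \<zero>\<^bsub>B\<^esub>,
      add = add B,
      smult = smult B,
      act = (\<lambda>h b. smash_E K H A (smash_j K H A h \<otimes>\<^bsub>B\<^esub> b)) \<rparr>)"

end

theory Submission
  imports Defs
begin

text \<open>
  Since \<open>(\<epsilon> \<otimes> id \<otimes> id)(\<Phi>)\<close> and \<open>(id \<otimes> id \<otimes> \<epsilon>)(\<Phi>)\<close> are trivial (apply \<open>\<epsilon>\<close> to an inner slot of the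
  pentagon identity), left and right multiplication by \<open>j(h)\<close> in \<open>A # H\<close> are explicit, and the
  axiom \<open>h\<^sub>1 \<beta> S(h\<^sub>2) = \<epsilon>(h) \<beta>\<close> reduces \<open>E(a # h)\<close> to \<open>\<epsilon>(h)\<close> times the value of the contraction
  \<open>w \<otimes> x \<otimes> y \<otimes> z \<mapsto> w \<cdot> a # x \<beta> S(y) \<alpha> z\<close> at \<open>(\<Delta> \<otimes> id \<otimes> id)(\<Phi>) (\<Phi>\<inverse> \<otimes> 1)\<close>.  By the pentagon this
  element is \<open>(id \<otimes> id \<otimes> \<Delta>)(\<Phi>\<inverse>) (1 \<otimes> \<Phi>) (id \<otimes> \<Delta> \<otimes> id)(\<Phi>)\<close>, where the antipode axioms collapse the
  comultiplied slots and \<open>X\<^sup>1 \<beta> S(X\<^sup>2) \<alpha> X\<^sup>3 = 1\<close> leaves \<open>a # 1\<close>.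
\<close>

section \<open>Tensor products\<close>

text \<open>A tensor is a coset and \<open>tsum\<close> evaluates one chosen representative, so a
  Sweedler sum has a meaning only once its summand is known to be bilinear. Reassociators are
  therefore not expanded: the element is replaced by a variable, both sides become linear maps in
  it, the identity is checked on pure tensors, and what is known about \<Phi> (pentagon, counit and
  antipode axioms) is substituted afterwards.

  The element q is built so that the inverse antipode disappears inside E: S(q^2) =
  S(S^{-1}(\<alpha> X^3) X^2) = S(X^2) \<alpha> X^3. For b = a # h the summand of E(b) becomes
  (X^1_1 x^1) . a # X^1_2 x^2 h_1 \<beta> S(h_2) S(x^3) S(X^2) \<alpha> X^3. Once h_1 \<beta> S(h_2)
  is absorbed, the slots X^1_1 x^1, X^1_2 x^2, X^2 x^3, X^3 are those of the element to which the
  pentagon is applied.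

  The module algebra axioms for the coinvariants are carried over from A along a |-> a # 1, so * and
  the action only have to be computed on A # 1.\<close>

definition bilin ::
  "('k, 'm) ring_scheme \<Rightarrow> ('k, 'a, 'p) module_scheme \<Rightarrow> ('k, 'b, 'q) module_scheme
    \<Rightarrow> ('k, 'c, 'r) module_scheme \<Rightarrow> ('a \<Rightarrow> 'b \<Rightarrow> 'c) \<Rightarrow> bool" where
  "bilin K M N P F \<longleftrightarrow> (\<forall>x \<in> carrier M. F x \<in> lin_hom K N P) \<and>
    (\<forall>y \<in> carrier N. (\<lambda>x. F x y) \<in> lin_hom K M P)"

lemma lin_homI:
  assumes "\<And>x. x \<in> carrier M \<Longrightarrow> f x \<in> carrier N"
    and "\<And>x y. x \<in> carrier M \<Longrightarrow> y \<in> carrier M \<Longrightarrow> f (x \<oplus>\<^bsub>M\<^esub> y) = f x \<oplus>\<^bsub>N\<^esub> f y"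
    and "\<And>c x. c \<in> carrier K \<Longrightarrow> x \<in> carrier M \<Longrightarrow> f (c \<odot>\<^bsub>M\<^esub> x) = c \<odot>\<^bsub>N\<^esub> f x"
  shows "f \<in> lin_hom K M N"
  using assms by (auto simp: lin_hom_def)

lemma lin_homD:
  assumes "f \<in> lin_hom K M N" "x \<in> carrier M"
  shows lin_hom_closed: "f x \<in> carrier N"
    and lin_hom_add: "y \<in> carrier M \<Longrightarrow> f (x \<oplus>\<^bsub>M\<^esub> y) = f x \<oplus>\<^bsub>N\<^esub> f y"
    and lin_hom_smult: "c \<in> carrier K \<Longrightarrow> f (c \<odot>\<^bsub>M\<^esub> x) = c \<odot>\<^bsub>N\<^esub> f x"
  using assms by (auto simp: lin_hom_def)

lemma lin_hom_zero:
  assumes "f \<in> lin_hom K M N" "module K M" "module K N"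
  shows "f \<zero>\<^bsub>M\<^esub> = \<zero>\<^bsub>N\<^esub>"
proof -
  interpret M: module K M by fact
  interpret N: module K N by fact
  have "f (\<zero>\<^bsub>K\<^esub> \<odot>\<^bsub>M\<^esub> \<zero>\<^bsub>M\<^esub>) = \<zero>\<^bsub>K\<^esub> \<odot>\<^bsub>N\<^esub> f \<zero>\<^bsub>M\<^esub>"
    using assms(1) by (intro lin_hom_smult) auto
  thus ?thesis using lin_hom_closed[OF assms(1), of "\<zero>\<^bsub>M\<^esub>"] by simp
qed

lemma bilinI:
  assumes "\<And>x. x \<in> carrier M \<Longrightarrow> F x \<in> lin_hom K N P"
    and "\<And>y. y \<in> carrier N \<Longrightarrow> (\<lambda>x. F x y) \<in> lin_hom K M P"
  shows "bilin K M N P F"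
  using assms by (auto simp: bilin_def)

lemma bilin_closed:
  "bilin K M N P F \<Longrightarrow> x \<in> carrier M \<Longrightarrow> y \<in> carrier N \<Longrightarrow> F x y \<in> carrier P"
  by (auto simp: bilin_def dest: lin_hom_closed)

subsection \<open>Free modules\<close>

lemma free_module_module:
  assumes "cring K" shows "module K (free_module K X)"
proof -
  interpret cring K by fact
  have fin: "finite {x. f x \<oplus>\<^bsub>K\<^esub> g x \<noteq> \<zero>\<^bsub>K\<^esub>}"
    if "finite {x. f x \<noteq> \<zero>\<^bsub>K\<^esub>}" "finite {x. g x \<noteq> \<zero>\<^bsub>K\<^esub>}" for f g :: "'c \<Rightarrow> 'a"
    by (rule finite_subset[OF _ finite_UnI[OF that]]) auto
  have fin': "finite {x. c \<otimes>\<^bsub>K\<^esub> f x \<noteq> \<zero>\<^bsub>K\<^esub>}"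
    if "finite {x. f x \<noteq> \<zero>\<^bsub>K\<^esub>}" "c \<in> carrier K" for c and f :: "'c \<Rightarrow> 'a"
    by (rule finite_subset[OF _ that(1)]) (use that in auto)
  let ?F = "{f. f \<in> X \<rightarrow> carrier K \<and> (\<forall>x. x \<notin> X \<longrightarrow> f x = \<zero>\<^bsub>K\<^esub>) \<and> finite {x. f x \<noteq> \<zero>\<^bsub>K\<^esub>}}"
  have cl: "f x \<in> carrier K" if "f \<in> ?F" for f x
    using that by (cases "x \<in> X") auto
  have add: "(\<lambda>x. f x \<oplus>\<^bsub>K\<^esub> g x) \<in> ?F" if "f \<in> ?F" "g \<in> ?F" for f g
    using that fin[of f g] by auto
  have sm: "(\<lambda>x. c \<otimes>\<^bsub>K\<^esub> f x) \<in> ?F" if "f \<in> ?F" "c \<in> carrier K" for c f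
    using that fin'[of f c] by auto
  have zero: "(\<lambda>_. \<zero>\<^bsub>K\<^esub>) \<in> ?F" by auto
  have neg: "(\<lambda>x. \<ominus>\<^bsub>K\<^esub> f x) \<in> ?F" if f: "f \<in> ?F" for f
  proof -
    have "{x. \<ominus>\<^bsub>K\<^esub> f x \<noteq> \<zero>\<^bsub>K\<^esub>} \<subseteq> {x. f x \<noteq> \<zero>\<^bsub>K\<^esub>}" by auto
    thus ?thesis using f by (auto intro: finite_subset)
  qed
  have sel: "carrier (free_module K X) = ?F"
    "f \<oplus>\<^bsub>free_module K X\<^esub> g = (\<lambda>x. f x \<oplus>\<^bsub>K\<^esub> g x)"
    "c \<odot>\<^bsub>free_module K X\<^esub> f = (\<lambda>x. c \<otimes>\<^bsub>K\<^esub> f x)"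
    "\<zero>\<^bsub>free_module K X\<^esub> = (\<lambda>_. \<zero>\<^bsub>K\<^esub>)" for f g c
    by (auto simp: free_module_def)
  have ag: "abelian_group (free_module K X)"
  proof (rule abelian_groupI, unfold sel)
    fix f assume f: "f \<in> ?F"
    show "\<exists>g\<in>?F. (\<lambda>x. g x \<oplus>\<^bsub>K\<^esub> f x) = (\<lambda>_. \<zero>\<^bsub>K\<^esub>)"
      by (rule bexI[OF _ neg[OF f]]) (simp add: cl[OF f] l_neg)
    show "(\<lambda>x. \<zero>\<^bsub>K\<^esub> \<oplus>\<^bsub>K\<^esub> f x) = f" by (simp add: cl[OF f])
    fix g assume g: "g \<in> ?F"
    show "(\<lambda>x. f x \<oplus>\<^bsub>K\<^esub> g x) = (\<lambda>x. g x \<oplus>\<^bsub>K\<^esub> f x)" by (simp add: cl[OF f] cl[OF g] a_comm)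
    fix h assume h: "h \<in> ?F"
    show "(\<lambda>x. f x \<oplus>\<^bsub>K\<^esub> g x \<oplus>\<^bsub>K\<^esub> h x) = (\<lambda>x. f x \<oplus>\<^bsub>K\<^esub> (g x \<oplus>\<^bsub>K\<^esub> h x))"
      by (simp add: cl[OF f] cl[OF g] cl[OF h] a_assoc)
  qed (rule add zero; assumption)+
  show ?thesis
  proof (rule moduleI[OF assms ag], unfold sel)
    fix f c assume f: "f \<in> ?F" and c: "c \<in> carrier K"
    show "(\<lambda>x. c \<otimes>\<^bsub>K\<^esub> f x) \<in> ?F" by (rule sm[OF f c])
    fix d assume d: "d \<in> carrier K"
    show "(\<lambda>x. (c \<oplus>\<^bsub>K\<^esub> d) \<otimes>\<^bsub>K\<^esub> f x) = (\<lambda>x. c \<otimes>\<^bsub>K\<^esub> f x \<oplus>\<^bsub>K\<^esub> d \<otimes>\<^bsub>K\<^esub> f x)"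
      by (simp add: cl[OF f] c d l_distr)
    show "(\<lambda>x. c \<otimes>\<^bsub>K\<^esub> d \<otimes>\<^bsub>K\<^esub> f x) = (\<lambda>x. c \<otimes>\<^bsub>K\<^esub> (d \<otimes>\<^bsub>K\<^esub> f x))"
      by (simp add: cl[OF f] c d m_assoc)
  next
    fix f assume f: "f \<in> ?F"
    show "(\<lambda>x. \<one>\<^bsub>K\<^esub> \<otimes>\<^bsub>K\<^esub> f x) = f" by (simp add: cl[OF f])
    fix g c assume g: "g \<in> ?F" and c: "c \<in> carrier K"
    show "(\<lambda>x. c \<otimes>\<^bsub>K\<^esub> (f x \<oplus>\<^bsub>K\<^esub> g x)) = (\<lambda>x. c \<otimes>\<^bsub>K\<^esub> f x \<oplus>\<^bsub>K\<^esub> c \<otimes>\<^bsub>K\<^esub> g x)"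
      by (simp add: cl[OF f] cl[OF g] c r_distr)
  qed
qed

lemma free_module_sel:
  "f \<oplus>\<^bsub>free_module K X\<^esub> g = (\<lambda>x. f x \<oplus>\<^bsub>K\<^esub> g x)"
  "c \<odot>\<^bsub>free_module K X\<^esub> f = (\<lambda>x. c \<otimes>\<^bsub>K\<^esub> f x)"
  "\<zero>\<^bsub>free_module K X\<^esub> = (\<lambda>_. \<zero>\<^bsub>K\<^esub>)"
  by (auto simp: free_module_def)

lemma free_gen_closed:
  assumes "cring K" "x \<in> X" shows "free_gen K x \<in> carrier (free_module K X)"
proof -
  interpret cring K by fact
  have "{y. free_gen K x y \<noteq> \<zero>\<^bsub>K\<^esub>} \<subseteq> {x}" by (auto simp: free_gen_def)
  thus ?thesis using assms(2)
    by (auto simp: free_module_def free_gen_def intro: finite_subset)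
qed

text \<open>The function is peeled off one point at a time, f = f(a := 0) + f(a) times the generator
  at a. The induction is over a finite superset of the support, so the shortened function satisfies
  its hypothesis even when f(a) was already 0.\<close>

lemma free_module_span:
  assumes "cring K" and U: "submodule U K (free_module K X)"
    and gen: "\<And>x. x \<in> X \<Longrightarrow> free_gen K x \<in> U"
    and f: "f \<in> carrier (free_module K X)"
  shows "f \<in> U"
proof -
  interpret cring K by fact
  interpret F: module K "free_module K X" by (rule free_module_module) fact
  note Uc = F.submoduleE[OF U]
  have "f \<in> U" if "finite S" "{x. f x \<noteq> \<zero>\<^bsub>K\<^esub>} \<subseteq> S" "f \<in> carrier (free_module K X)" for S f
    using that
  proof (induction S arbitrary: f)
    case empty
    hence "f = \<zero>\<^bsub>free_module K X\<^esub>" by (auto simp: free_module_sel)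
    moreover have "\<zero>\<^bsub>free_module K X\<^esub> \<in> U"
      using Uc(2) Uc(4)[of "\<zero>\<^bsub>K\<^esub>"] Uc(1) by (metis F.smult_l_null all_not_in_conv subsetD zero_closed)
    ultimately show ?case by simp
  next
    case (insert a S)
    have cl: "f x \<in> carrier K" for x
      using insert.prems(2) by (cases "x \<in> X") (auto simp: free_module_def)
    show ?case
    proof (cases "a \<in> X")
      case False
      hence "f a = \<zero>\<^bsub>K\<^esub>" using insert.prems by (auto simp: free_module_def)
      thus ?thesis using insert.prems by (intro insert.IH) auto
    next
      case True
      let ?g = "f(a := \<zero>\<^bsub>K\<^esub>)"
      have "finite {x. f x \<noteq> \<zero>\<^bsub>K\<^esub>}" using insert.prems by (auto simp: free_module_def)
      hence "finite {x. ?g x \<noteq> \<zero>\<^bsub>K\<^esub>}" by (rule finite_subset[rotated]) auto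
      hence g: "?g \<in> carrier (free_module K X)"
        using insert.prems True by (auto simp: free_module_def)
      have "?g \<in> U" using insert.prems by (intro insert.IH g) auto
      moreover have "f a \<odot>\<^bsub>free_module K X\<^esub> free_gen K a \<in> U"
        using Uc(4) gen[OF True] cl by auto
      moreover have "f = ?g \<oplus>\<^bsub>free_module K X\<^esub> f a \<odot>\<^bsub>free_module K X\<^esub> free_gen K a"
        using cl by (auto simp: free_module_sel free_gen_def)
      ultimately show ?thesis using Uc(5) by metis
    qed
  qed
  thus ?thesis using f by (auto simp: free_module_def)
qed

lemma submodule_zero: "submodule U K M \<Longrightarrow> \<zero>\<^bsub>M\<^esub> \<in> U"
  using subgroup.one_closed[OF submodule.axioms(1)] by fastforce

text \<open>The linear extension of F to the free module. The sum is the one inside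
  \<open>tsum\<close>, which is thus \<open>free_ev\<close> at the chosen representative.\<close>

definition free_ev ::
  "('k, 'm) ring_scheme \<Rightarrow> ('k, 'p, 'r) module_scheme \<Rightarrow> ('x \<Rightarrow> 'p) \<Rightarrow> ('x \<Rightarrow> 'k) \<Rightarrow> 'p" where
  "free_ev K P F f = finsum P (\<lambda>x. f x \<odot>\<^bsub>P\<^esub> F x) {x. f x \<noteq> \<zero>\<^bsub>K\<^esub>}"

text \<open>The support changes with the function. To compare the sums for f, g and f + g they are
  all taken over one finite set; the added terms are zero.\<close>

lemma free_ev_superset:
  assumes P: "module K P" and F: "F \<in> X \<rightarrow> carrier P" and f: "f \<in> carrier (free_module K X)"
    and S: "finite S" "{x. f x \<noteq> \<zero>\<^bsub>K\<^esub>} \<subseteq> S" "S \<subseteq> X"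
  shows "free_ev K P F f = finsum P (\<lambda>x. f x \<odot>\<^bsub>P\<^esub> F x) S"
proof -
  interpret P: module K P by fact
  have cl: "f x \<in> carrier K" for x
    using f by (cases "x \<in> X") (auto simp: free_module_def)
  show ?thesis unfolding free_ev_def
    by (rule P.add.finprod_mono_neutral_cong_left) (use S F cl in \<open>auto simp: Pi_def\<close>)
qed

lemma free_ev_linear:
  assumes P: "module K P" and F: "F \<in> X \<rightarrow> carrier P"
  shows "free_ev K P F \<in> lin_hom K (free_module K X) P"
proof -
  interpret P: module K P by fact
  interpret F: module K "free_module K X" by (rule free_module_module) unfold_locales
  have cl: "f x \<in> carrier K" if "f \<in> carrier (free_module K X)" for f x
    using that by (cases "x \<in> X") (auto simp: free_module_def)
  let ?s = "\<lambda>f. {x. f x \<noteq> \<zero>\<^bsub>K\<^esub>}"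
  have s: "finite (?s f)" "?s f \<subseteq> X" if "f \<in> carrier (free_module K X)" for f
    using that by (auto simp: free_module_def)
  have FX: "F x \<in> carrier P" if "x \<in> X" for x using F that by auto
  show ?thesis
  proof (rule lin_homI)
    fix f assume f: "f \<in> carrier (free_module K X)"
    show "free_ev K P F f \<in> carrier P"
      unfolding free_ev_def by (rule P.finsum_closed) (use s[OF f] cl[OF f] FX in auto)
    fix g assume g: "g \<in> carrier (free_module K X)"
    let ?S = "?s f \<union> ?s g"
    have S: "finite ?S" "?S \<subseteq> X" using s f g by auto
    have "free_ev K P F (f \<oplus>\<^bsub>free_module K X\<^esub> g)
        = finsum P (\<lambda>x. (f x \<oplus>\<^bsub>K\<^esub> g x) \<odot>\<^bsub>P\<^esub> F x) ?S"
      unfolding free_module_sel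
    proof (rule free_ev_superset[OF P F _ S(1) _ S(2)])
      show "(\<lambda>x. f x \<oplus>\<^bsub>K\<^esub> g x) \<in> carrier (free_module K X)"
        using F.a_closed[OF f g] by (simp only: free_module_sel)
      show "{x. f x \<oplus>\<^bsub>K\<^esub> g x \<noteq> \<zero>\<^bsub>K\<^esub>} \<subseteq> ?S" by auto
    qed
    also have "\<dots> = finsum P (\<lambda>x. f x \<odot>\<^bsub>P\<^esub> F x \<oplus>\<^bsub>P\<^esub> g x \<odot>\<^bsub>P\<^esub> F x) ?S"
      by (rule P.add.finprod_cong') (use S FX cl f g in \<open>auto simp: P.smult_l_distr subset_iff\<close>)
    also have "\<dots> = finsum P (\<lambda>x. f x \<odot>\<^bsub>P\<^esub> F x) ?S \<oplus>\<^bsub>P\<^esub> finsum P (\<lambda>x. g x \<odot>\<^bsub>P\<^esub> F x) ?S"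
      by (rule P.finsum_addf) (use S FX cl f g in \<open>auto simp: subset_iff\<close>)
    also have "\<dots> = free_ev K P F f \<oplus>\<^bsub>P\<^esub> free_ev K P F g"
      using free_ev_superset[OF P F f S(1) _ S(2)] free_ev_superset[OF P F g S(1) _ S(2)] by auto
    finally show "free_ev K P F (f \<oplus>\<^bsub>free_module K X\<^esub> g) = free_ev K P F f \<oplus>\<^bsub>P\<^esub> free_ev K P F g" .
  next
    fix c f assume c: "c \<in> carrier K" and f: "f \<in> carrier (free_module K X)"
    have "free_ev K P F (c \<odot>\<^bsub>free_module K X\<^esub> f)
        = finsum P (\<lambda>x. (c \<otimes>\<^bsub>K\<^esub> f x) \<odot>\<^bsub>P\<^esub> F x) (?s f)"
      unfolding free_module_sel
    proof (rule free_ev_superset[OF P F _ s(1)[OF f] _ s(2)[OF f]])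
      show "(\<lambda>x. c \<otimes>\<^bsub>K\<^esub> f x) \<in> carrier (free_module K X)"
        using F.smult_closed[OF c f] by (simp only: free_module_sel)
      show "{x. c \<otimes>\<^bsub>K\<^esub> f x \<noteq> \<zero>\<^bsub>K\<^esub>} \<subseteq> ?s f" using c by auto
    qed
    also have "\<dots> = finsum P (\<lambda>x. c \<odot>\<^bsub>P\<^esub> (f x \<odot>\<^bsub>P\<^esub> F x)) (?s f)"
      by (rule P.add.finprod_cong') (use s[OF f] FX cl f c in \<open>auto simp: P.smult_assoc1 subset_iff\<close>)
    also have "\<dots> = c \<odot>\<^bsub>P\<^esub> free_ev K P F f" unfolding free_ev_def
      by (rule P.finsum_smult_ldistr[symmetric]) (use s[OF f] FX cl f c in \<open>auto simp: subset_iff\<close>)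
    finally show "free_ev K P F (c \<odot>\<^bsub>free_module K X\<^esub> f) = c \<odot>\<^bsub>P\<^esub> free_ev K P F f" .
  qed
qed

lemma free_ev_gen:
  assumes P: "module K P" and F: "F \<in> X \<rightarrow> carrier P" and x: "x \<in> X"
  shows "free_ev K P F (free_gen K x) = F x"
proof -
  interpret P: module K P by fact
  have "free_ev K P F (free_gen K x) = finsum P (\<lambda>y. free_gen K x y \<odot>\<^bsub>P\<^esub> F y) {x}"
    by (rule free_ev_superset[OF P F free_gen_closed])
      (use x in \<open>auto simp: free_gen_def P.R.is_cring split: if_splits\<close>)
  also have "\<dots> = F x" using funcset_mem[OF F x] by (subst P.finsum_insert) (auto simp: free_gen_def)
  finally show ?thesis .
qed

text \<open>Membership in \<open>lin_hom\<close> speaks of sums and scalars only, so subtraction is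
  read as adding (-1) y.\<close>

lemma lin_hom_minus:
  assumes "f \<in> lin_hom K M N" "module K M" "module K N" "x \<in> carrier M" "y \<in> carrier M"
  shows "f (x \<ominus>\<^bsub>M\<^esub> y) = f x \<ominus>\<^bsub>N\<^esub> f y"
proof -
  interpret M: module K M by fact
  interpret N: module K N by fact
  have "f (x \<ominus>\<^bsub>M\<^esub> y) = f (x \<oplus>\<^bsub>M\<^esub> (\<ominus>\<^bsub>K\<^esub> \<one>\<^bsub>K\<^esub>) \<odot>\<^bsub>M\<^esub> y)"
    using assms(4,5) by (simp add: M.smult_l_minus a_minus_def)
  also have "\<dots> = f x \<ominus>\<^bsub>N\<^esub> f y"
    using assms(4,5) lin_hom_closed[OF assms(1)]
    by (simp add: lin_hom_add[OF assms(1)] lin_hom_smult[OF assms(1)] N.smult_l_minus a_minus_def)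
  finally show ?thesis .
qed

text \<open>It has two uses: with the generators it shows that linear maps agree everywhere, and
  with g = 0 it makes a kernel a submodule that can absorb the tensor relations.\<close>

lemma lin_hom_equalizer:
  assumes "f \<in> lin_hom K M N" "g \<in> lin_hom K M N" "module K M" "module K N"
  shows "submodule {x \<in> carrier M. f x = g x} K M"
proof -
  interpret M: module K M by fact
  interpret N: module K N by fact
  show ?thesis
  proof (rule M.submoduleI)
    fix a assume "a \<in> {x \<in> carrier M. f x = g x}"
    hence a: "a \<in> carrier M" "f a = g a" by auto
    have "f (\<ominus>\<^bsub>M\<^esub> a) = f (\<zero>\<^bsub>M\<^esub> \<ominus>\<^bsub>M\<^esub> a)" using a by (simp add: a_minus_def)
    also have "\<dots> = g (\<zero>\<^bsub>M\<^esub> \<ominus>\<^bsub>M\<^esub> a)"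
      using a by (simp add: lin_hom_minus[OF assms(1,3,4)] lin_hom_minus[OF assms(2,3,4)]
          lin_hom_zero[OF assms(1,3,4)] lin_hom_zero[OF assms(2,3,4)])
    also have "\<dots> = g (\<ominus>\<^bsub>M\<^esub> a)" using a by (simp add: a_minus_def)
    finally show "\<ominus>\<^bsub>M\<^esub> a \<in> {x \<in> carrier M. f x = g x}" using a by simp
  qed (use assms in \<open>auto simp: lin_hom_add lin_hom_smult lin_hom_zero\<close>)
qed

lemma zero_lin_hom: "module K M \<Longrightarrow> module K N \<Longrightarrow> (\<lambda>_. \<zero>\<^bsub>N\<^esub>) \<in> lin_hom K M N"
proof -
  assume "module K M" "module K N"
  interpret N: module K N by fact
  show ?thesis by (rule lin_homI) auto
qed

subsection \<open>The universal property\<close>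

locale tensor_pair = M: module K M + N: module K N
  for K :: "('k, 'm) ring_scheme" and M :: "('k, 'a, 'p) module_scheme"
    and N :: "('k, 'b, 'q) module_scheme"
begin

abbreviation "TF \<equiv> tensor_free K M N"
abbreviation "TN \<equiv> tensor_null K M N"

sublocale F: module K TF
  by (rule free_module_module) unfold_locales

lemma gen_closed: "x \<in> carrier M \<Longrightarrow> y \<in> carrier N \<Longrightarrow> free_gen K (x, y) \<in> carrier TF"
  by (intro free_gen_closed) (auto intro: M.R.is_cring)

lemma tensor_rels_closed: "tensor_rels K M N \<subseteq> carrier TF"
  by (auto elim!: tensor_rels.cases intro!: gen_closed F.minus_closed F.a_closed F.smult_closed)

lemma tensor_null_submodule: "submodule TN K TF"
proof (rule F.submoduleI)
  have "submodule (carrier TF) K TF" by (rule F.carrier_is_submodule)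
  thus "TN \<subseteq> carrier TF" using tensor_rels_closed unfolding tensor_null_def by blast
qed (auto simp: tensor_null_def F.submoduleE submodule_zero)

sublocale Q: abelian_subgroup TN TF
  by (rule abelian_subgroupI3)
    (auto simp: additive_subgroup_def F.abelian_group_axioms
      intro: submodule.axioms[OF tensor_null_submodule])

lemma tensor_null_minimal:
  assumes "submodule U K TF" "tensor_rels K M N \<subseteq> U" shows "TN \<subseteq> U"
  using assms unfolding tensor_null_def by blast

text \<open>Scaling a coset elementwise need not give a whole coset; for c = 0 only the zero
  function is left. The definition adds \<open>TN\<close> back, and the two inclusions check that
  this yields the coset of c f.\<close>

lemma smult_coset:
  assumes "c \<in> carrier K" "f \<in> carrier TF"
  shows "c \<odot>\<^bsub>tensor_module K M N\<^esub> (TN +>\<^bsub>TF\<^esub> f) = TN +>\<^bsub>TF\<^esub> (c \<odot>\<^bsub>TF\<^esub> f)"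
proof -
  note sub = submodule.smult_closed[OF tensor_null_submodule]
  show ?thesis (is "?l = ?r")
  proof
    show "?l \<subseteq> ?r"
    proof
      fix x assume "x \<in> ?l"
      then obtain n n' where n: "n \<in> TN" "n' \<in> TN"
        "x = n \<oplus>\<^bsub>TF\<^esub> c \<odot>\<^bsub>TF\<^esub> (n' \<oplus>\<^bsub>TF\<^esub> f)"
        by (auto simp: tensor_module_def set_add_def' a_r_coset_def')
      hence "x = (n \<oplus>\<^bsub>TF\<^esub> c \<odot>\<^bsub>TF\<^esub> n') \<oplus>\<^bsub>TF\<^esub> c \<odot>\<^bsub>TF\<^esub> f"
        using assms by (simp add: F.smult_r_distr F.a_assoc)
      thus "x \<in> ?r" using n sub[OF assms(1) n(2)] by (auto simp: a_r_coset_def')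
    qed
    show "?r \<subseteq> ?l"
    proof
      fix x assume "x \<in> ?r"
      then obtain n where n: "n \<in> TN" "x = n \<oplus>\<^bsub>TF\<^esub> c \<odot>\<^bsub>TF\<^esub> f"
        by (auto simp: a_r_coset_def')
      moreover have "f \<in> TN +>\<^bsub>TF\<^esub> f" using assms by (simp add: Q.a_rcos_self)
      ultimately show "x \<in> ?l" by (auto simp: tensor_module_def set_add_def')
    qed
  qed
qed

lemma add_coset:
  assumes "f \<in> carrier TF" "g \<in> carrier TF"
  shows "(TN +>\<^bsub>TF\<^esub> f) \<oplus>\<^bsub>tensor_module K M N\<^esub> (TN +>\<^bsub>TF\<^esub> g) = TN +>\<^bsub>TF\<^esub> (f \<oplus>\<^bsub>TF\<^esub> g)"
  using assms by (simp add: tensor_module_def Q.a_rcos_sum)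

lemma coset_closed: "f \<in> carrier TF \<Longrightarrow> TN +>\<^bsub>TF\<^esub> f \<in> carrier (tensor_module K M N)"
  by (simp add: tensor_module_def F.a_rcosetsI Q.a_subset)

lemma cosetE:
  assumes "t \<in> carrier (tensor_module K M N)"
  obtains f where "f \<in> carrier TF" "t = TN +>\<^bsub>TF\<^esub> f"
  using assms by (auto simp: tensor_module_def A_RCOSETS_def')

lemma zero_coset: "\<zero>\<^bsub>tensor_module K M N\<^esub> = TN +>\<^bsub>TF\<^esub> \<zero>\<^bsub>TF\<^esub>"
  by (simp add: tensor_module_def Q.a_subset)

lemma tensor_module: "module K (tensor_module K M N)"
proof (rule moduleI)
  show "cring K" by (rule M.R.is_cring)
  show "abelian_group (tensor_module K M N)"
  proof (rule abelian_groupI)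
    fix t assume "t \<in> carrier (tensor_module K M N)"
    then obtain f where f: "f \<in> carrier TF" "t = TN +>\<^bsub>TF\<^esub> f" by (rule cosetE)
    show "\<exists>u\<in>carrier (tensor_module K M N). u \<oplus>\<^bsub>tensor_module K M N\<^esub> t = \<zero>\<^bsub>tensor_module K M N\<^esub>"
      by (rule bexI[of _ "TN +>\<^bsub>TF\<^esub> (\<ominus>\<^bsub>TF\<^esub> f)"])
        (use f in \<open>auto simp: add_coset coset_closed F.l_neg zero_coset\<close>)
  qed (auto elim!: cosetE simp: add_coset coset_closed zero_coset F.a_ac)
qed (auto elim!: cosetE simp: smult_coset add_coset coset_closed F.smult_l_distr F.smult_r_distr F.smult_assoc1)

lemma tpure_closed [simp]:
  "x \<in> carrier M \<Longrightarrow> y \<in> carrier N \<Longrightarrow> tpure K M N x y \<in> carrier (tensor_module K M N)"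
  by (simp add: tpure_def coset_closed gen_closed)

lemma coset_eqI:
  assumes "f \<in> carrier TF" "g \<in> carrier TF" "f \<ominus>\<^bsub>TF\<^esub> g \<in> tensor_rels K M N"
  shows "TN +>\<^bsub>TF\<^esub> f = TN +>\<^bsub>TF\<^esub> g"
proof -
  have "f \<oplus>\<^bsub>TF\<^esub> \<ominus>\<^bsub>TF\<^esub> g \<in> TN"
    using assms(3) by (auto simp: tensor_null_def a_minus_def)
  hence "f \<in> TN +>\<^bsub>TF\<^esub> g" using assms by (simp add: Q.a_rcos_module)
  thus ?thesis using Q.a_repr_independence' assms(2) by metis
qed

lemma tpure_bilin: "bilin K M N (tensor_module K M N) (tpure K M N)"
proof -
  note eq = coset_eqI[OF _ _ tensor_rels.add_left] coset_eqI[OF _ _ tensor_rels.add_right]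
    coset_eqI[OF _ _ tensor_rels.smult_left] coset_eqI[OF _ _ tensor_rels.smult_right]
  show ?thesis
    by (intro bilinI lin_homI)
      (simp_all add: tpure_def add_coset smult_coset gen_closed coset_closed eq)
qed

lemma coset_lin_hom: "(\<lambda>f. TN +>\<^bsub>TF\<^esub> f) \<in> lin_hom K TF (tensor_module K M N)"
  by (rule lin_homI) (auto simp: coset_closed add_coset smult_coset)

text \<open>Composed with the quotient map, both maps live on the free module, where their equalizer
  is a submodule containing all generators. This is the rule behind nearly every later
  identity.\<close>

lemma tensor_ext:
  assumes "f \<in> lin_hom K (tensor_module K M N) P" "g \<in> lin_hom K (tensor_module K M N) P"
    and P: "module K P"
    and eq: "\<And>x y. x \<in> carrier M \<Longrightarrow> y \<in> carrier N \<Longrightarrow> f (tpure K M N x y) = g (tpure K M N x y)"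
    and t: "t \<in> carrier (tensor_module K M N)"
  shows "f t = g t"
proof -
  obtain h where h: "h \<in> carrier TF" "t = TN +>\<^bsub>TF\<^esub> h" using t by (rule cosetE)
  have comp: "(\<lambda>h. k (TN +>\<^bsub>TF\<^esub> h)) \<in> lin_hom K TF P"
    if "k \<in> lin_hom K (tensor_module K M N) P" for k
    using lin_homD[OF that] lin_homD[OF coset_lin_hom] by (intro lin_homI) auto
  have "h \<in> {h \<in> carrier TF. f (TN +>\<^bsub>TF\<^esub> h) = g (TN +>\<^bsub>TF\<^esub> h)}"
    by (rule free_module_span[OF M.R.is_cring lin_hom_equalizer[OF comp comp]])
      (use assms h in \<open>auto simp: gen_closed F.module_axioms tpure_def\<close>)
  thus ?thesis using h by simp
qed

text \<open>Independence of the representative: as F is bilinear, evaluation kills every tensor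
  relation, hence by minimality all of \<open>TN\<close>. The representative picked by choice
  differs from f by an element of \<open>TN\<close>.\<close>

lemma tsum_coset:
  assumes P: "module K P" and F: "bilin K M N P F" and f: "f \<in> carrier TF"
  shows "tsum K P (TN +>\<^bsub>TF\<^esub> f) F = free_ev K P (\<lambda>(x, y). F x y) f"
proof -
  interpret P: module K P by fact
  define G where "G = (\<lambda>(x, y). F x y)"
  have FX: "G \<in> carrier M \<times> carrier N \<rightarrow> carrier P"
    by (auto simp: G_def intro: bilin_closed[OF F])
  note ev = free_ev_linear[OF P FX]
  define g where "g = (SOME g. g \<in> TN +>\<^bsub>TF\<^esub> f)"
  have "f \<in> TN +>\<^bsub>TF\<^esub> f" using f by (simp add: Q.a_rcos_self)
  hence g: "g \<in> TN +>\<^bsub>TF\<^esub> f" unfolding g_def by (rule someI[where P = "\<lambda>g. g \<in> TN +>\<^bsub>TF\<^esub> f"])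
  let ?U = "{h \<in> carrier TF. free_ev K P G h = \<zero>\<^bsub>P\<^esub>}"
  have "submodule ?U K TF"
    by (rule lin_hom_equalizer[OF ev zero_lin_hom]) (rule F.module_axioms P)+
  moreover have "tensor_rels K M N \<subseteq> ?U"
  proof
    fix r assume r: "r \<in> tensor_rels K M N"
    have self: "p \<ominus>\<^bsub>P\<^esub> p = \<zero>\<^bsub>P\<^esub>" if "p \<in> carrier P" for p
      using that by (simp add: a_minus_def P.M.r_neg)
    have Gxy: "G (x, y) \<in> carrier P" if "x \<in> carrier M" "y \<in> carrier N" for x y
      using FX that by auto
    note lin = lin_hom_minus[OF ev F.module_axioms P] lin_hom_add[OF ev] lin_hom_smult[OF ev]
      gen_closed free_ev_gen[OF P FX]
    have G1: "G (x \<oplus>\<^bsub>M\<^esub> y, z) = G (x, z) \<oplus>\<^bsub>P\<^esub> G (y, z)"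
      if "x \<in> carrier M" "y \<in> carrier M" "z \<in> carrier N" for x y z
      using F that lin_hom_add[of "\<lambda>x. F x z" K M P] by (auto simp: G_def bilin_def)
    have G2: "G (x, y \<oplus>\<^bsub>N\<^esub> z) = G (x, y) \<oplus>\<^bsub>P\<^esub> G (x, z)"
      if "x \<in> carrier M" "y \<in> carrier N" "z \<in> carrier N" for x y z
      using F that lin_hom_add[of "F x" K N P] by (auto simp: G_def bilin_def)
    have G3: "G (c \<odot>\<^bsub>M\<^esub> x, z) = c \<odot>\<^bsub>P\<^esub> G (x, z)"
      if "c \<in> carrier K" "x \<in> carrier M" "z \<in> carrier N" for c x z
      using F that lin_hom_smult[of "\<lambda>x. F x z" K M P] by (auto simp: G_def bilin_def)
    have G4: "G (x, c \<odot>\<^bsub>N\<^esub> z) = c \<odot>\<^bsub>P\<^esub> G (x, z)"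
      if "c \<in> carrier K" "x \<in> carrier M" "z \<in> carrier N" for c x z
      using F that lin_hom_smult[of "F x" K N P] by (auto simp: G_def bilin_def)
    have "free_ev K P G r = \<zero>\<^bsub>P\<^esub>" using r
      by (cases rule: tensor_rels.cases) (simp_all add: lin Gxy self G1 G2 G3 G4)
    thus "r \<in> ?U" using r tensor_rels_closed by auto
  qed
  ultimately have TN: "TN \<subseteq> ?U" by (rule tensor_null_minimal)
  obtain n where n: "n \<in> TN" "g = n \<oplus>\<^bsub>TF\<^esub> f" using g by (auto simp: a_r_coset_def')
  have "free_ev K P G g = free_ev K P G f"
    using n TN f lin_hom_closed[OF ev] by (auto simp: lin_hom_add[OF ev])
  moreover have "tsum K P (TN +>\<^bsub>TF\<^esub> f) F = free_ev K P G g"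
    unfolding tsum_def g_def free_ev_def G_def Let_def by (simp add: case_prod_unfold)
  ultimately show ?thesis by (simp add: G_def)
qed

lemma tsum_linear:
  assumes P: "module K P" and F: "bilin K M N P F"
  shows "(\<lambda>t. tsum K P t F) \<in> lin_hom K (tensor_module K M N) P"
proof -
  have FX: "(\<lambda>(x, y). F x y) \<in> carrier M \<times> carrier N \<rightarrow> carrier P"
    by (auto intro: bilin_closed[OF F])
  note ev = lin_homD[OF free_ev_linear[OF P FX]]
  show ?thesis
    by (rule lin_homI)
      (auto elim!: cosetE simp: ev tsum_coset[OF P F] add_coset smult_coset)
qed

lemma tsum_pure:
  assumes P: "module K P" and F: "bilin K M N P F" and "x \<in> carrier M" "y \<in> carrier N"
  shows "tsum K P (tpure K M N x y) F = F x y"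
proof -
  have FX: "(\<lambda>(x, y). F x y) \<in> carrier M \<times> carrier N \<rightarrow> carrier P"
    by (auto intro: bilin_closed[OF F])
  show ?thesis using assms(3,4)
    by (simp add: tpure_def tsum_coset[OF P F] gen_closed free_ev_gen[OF P FX])
qed

end

subsection \<open>Calculus of linear maps\<close>

lemma lin_hom_id: "(\<lambda>x. x) \<in> lin_hom K M M"
  by (auto simp: lin_hom_def)

lemma lin_hom_compose:
  "f \<in> lin_hom K N P \<Longrightarrow> g \<in> lin_hom K M N \<Longrightarrow> (\<lambda>x. f (g x)) \<in> lin_hom K M P"
  by (auto simp: lin_hom_def Pi_def)

lemma bilin_left:
  "bilin K M N P F \<Longrightarrow> f \<in> lin_hom K Q M \<Longrightarrow> y \<in> carrier N \<Longrightarrow> (\<lambda>x. F (f x) y) \<in> lin_hom K Q P"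
  unfolding bilin_def using lin_hom_compose[where f = "\<lambda>x. F x y"] by blast

lemma bilin_right:
  "bilin K M N P F \<Longrightarrow> x \<in> carrier M \<Longrightarrow> f \<in> lin_hom K Q N \<Longrightarrow> (\<lambda>y. F x (f y)) \<in> lin_hom K Q P"
  unfolding bilin_def using lin_hom_compose[where f = "F x"] by blast

lemma lin_hom_plus:
  assumes "module K N" "f \<in> lin_hom K M N" "g \<in> lin_hom K M N"
  shows "(\<lambda>x. f x \<oplus>\<^bsub>N\<^esub> g x) \<in> lin_hom K M N"
proof -
  interpret N: module K N by fact
  show ?thesis using lin_homD[OF assms(2)] lin_homD[OF assms(3)]
    by (intro lin_homI) (simp_all add: N.M.a_ac N.smult_r_distr)
qed

lemma lin_hom_scale:
  assumes "module K N" "f \<in> lin_hom K M N" "c \<in> carrier K"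
  shows "(\<lambda>x. c \<odot>\<^bsub>N\<^esub> f x) \<in> lin_hom K M N"
proof -
  interpret N: module K N by fact
  show ?thesis using lin_homD[OF assms(2)] assms(3)
    by (intro lin_homI) (simp_all add: N.smult_r_distr N.smult_assoc1[symmetric] N.R.m_comm)
qed

context
  fixes K :: "('k, 'm) ring_scheme" and M :: "('k, 'a, 'p) module_scheme"
    and N :: "('k, 'b, 'q) module_scheme"
  assumes M: "module K M" and N: "module K N"
begin

interpretation tensor_pair K M N
  using M N by (rule tensor_pair.intro)

text \<open>Exported with explicit module hypotheses, so that one set of rules serves all iterated
  tensor products without an interpretation for each of them.\<close>

lemmas module_tensor_module = tensor_module
  and tpure_carrier = tpure_closed
  and bilin_tpure = tpure_bilin
  and lin_hom_tsum = tsum_linear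
  and tsum_tpure = tsum_pure
  and lin_hom_tensor_eqI = tensor_ext

lemma tsum_carrier:
  assumes "module K P" "bilin K M N P F" "t \<in> carrier (tensor_module K M N)"
  shows "tsum K P t F \<in> carrier P"
  using lin_hom_closed[OF tsum_linear] assms by metis

text \<open>This is what allows Sweedler sums to be nested: an inner sum depends linearly on the
  outer variables. For a pure t the claim is the assumption on F; the rest is linearity in
  t.\<close>

lemma lin_hom_tsum_param:
  assumes P: "module K P" and t: "t \<in> carrier (tensor_module K M N)"
    and F: "\<And>x. x \<in> carrier Q \<Longrightarrow> bilin K M N P (F x)"
    and Q: "\<And>y z. y \<in> carrier M \<Longrightarrow> z \<in> carrier N \<Longrightarrow> (\<lambda>x. F x y z) \<in> lin_hom K Q P"
    and Qm: "module K Q"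
  shows "(\<lambda>x. tsum K P t (F x)) \<in> lin_hom K Q P"
proof -
  interpret Q: module K Q by fact
  show ?thesis
  proof (rule lin_homI)
    fix x assume x: "x \<in> carrier Q"
    show "tsum K P t (F x) \<in> carrier P" by (rule tsum_carrier[OF P F[OF x] t])
    fix y assume y: "y \<in> carrier Q"
    show "tsum K P t (F (x \<oplus>\<^bsub>Q\<^esub> y)) = tsum K P t (F x) \<oplus>\<^bsub>P\<^esub> tsum K P t (F y)"
      by (rule tensor_ext[OF tsum_linear lin_hom_plus[OF _ tsum_linear tsum_linear] _ _ t])
        (simp_all add: P F x y tsum_pure lin_hom_add[OF Q])
  next
    fix c x assume c: "c \<in> carrier K" and x: "x \<in> carrier Q"
    show "tsum K P t (F (c \<odot>\<^bsub>Q\<^esub> x)) = c \<odot>\<^bsub>P\<^esub> tsum K P t (F x)"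
      by (rule tensor_ext[OF tsum_linear lin_hom_scale[OF _ tsum_linear] _ _ t])
        (simp_all add: P F x c tsum_pure lin_hom_smult[OF Q])
  qed
qed

lemma tsum_cong:
  assumes P: "module K P" and t: "t \<in> carrier (tensor_module K M N)"
    and F: "bilin K M N P F" and G: "bilin K M N P G"
    and eq: "\<And>x y. x \<in> carrier M \<Longrightarrow> y \<in> carrier N \<Longrightarrow> F x y = G x y"
  shows "tsum K P t F = tsum K P t G"
  by (rule tensor_ext[OF tsum_linear tsum_linear P _ t]) (simp_all add: P F G tsum_pure eq)

end

subsection \<open>Independence of the multiplicative structure\<close>

lemma tensor_rels_update:
  "tensor_rels K (M\<lparr>mult := m, one := e\<rparr>) N = tensor_rels K M N"
  "tensor_rels K N (M\<lparr>mult := m, one := e\<rparr>) = tensor_rels K N M"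
proof -
  show "tensor_rels K (M\<lparr>mult := m, one := e\<rparr>) N = tensor_rels K M N"
    by (rule Set.set_eqI) (simp add: tensor_rels.simps)
  show "tensor_rels K N (M\<lparr>mult := m, one := e\<rparr>) = tensor_rels K N M"
    by (rule Set.set_eqI) (simp add: tensor_rels.simps)
qed

lemma finsum_update: "finsum (M\<lparr>mult := m, one := e\<rparr>) = finsum M"
  by (intro ext) (simp add: finsum_def)

lemma module_update: "module K (M\<lparr>mult := m, one := e\<rparr>) = module K M"
  unfolding module_def abelian_group_def abelian_monoid_def abelian_group_axioms_def
    module_axioms_def by simp

lemma linear_update:
  "tpure K (M\<lparr>mult := m, one := e\<rparr>) N = tpure K M N"
  "tpure K N (M\<lparr>mult := m, one := e\<rparr>) = tpure K N M"
  "tensor_module K (M\<lparr>mult := m, one := e\<rparr>) N = tensor_module K M N"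
  "tensor_module K N (M\<lparr>mult := m, one := e\<rparr>) = tensor_module K N M"
  "lin_hom K (M\<lparr>mult := m, one := e\<rparr>) N = lin_hom K M N"
  "lin_hom K N (M\<lparr>mult := m, one := e\<rparr>) = lin_hom K N M"
  "tsum K (M\<lparr>mult := m, one := e\<rparr>) = tsum K M"
  by (simp_all add: tpure_def[abs_def] tensor_module_def lin_hom_def tensor_null_def
      tensor_rels_update tsum_def[abs_def] finsum_update)

text \<open>\<open>tensor\<close> overwrites only the product and the unit of
  \<open>tensor_module\<close>. These rules bring every linear notion to
  \<open>tensor_module\<close> form, so that \<open>tensor\<close> remains visible only in products
  and units.\<close>

lemma tensor_simps [simp]:
  "carrier (tensor K M N) = carrier (tensor_module K M N)"
  "add (tensor K M N) = add (tensor_module K M N)"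
  "zero (tensor K M N) = zero (tensor_module K M N)"
  "smult (tensor K M N) = smult (tensor_module K M N)"
  "module K (tensor K M N) = module K (tensor_module K M N)"
  "tpure K (tensor K M N) P = tpure K (tensor_module K M N) P"
  "tpure K P (tensor K M N) = tpure K P (tensor_module K M N)"
  "tensor_module K (tensor K M N) P = tensor_module K (tensor_module K M N) P"
  "tensor_module K P (tensor K M N) = tensor_module K P (tensor_module K M N)"
  "lin_hom K (tensor K M N) P = lin_hom K (tensor_module K M N) P"
  "lin_hom K P (tensor K M N) = lin_hom K P (tensor_module K M N)"
  "tsum K (tensor K M N) = tsum K (tensor_module K M N)"
  "tsum3 K (tensor K M N) = tsum3 K (tensor_module K M N)"
  "bilin K (tensor K M N) = bilin K (tensor_module K M N)"
  "bilin K P (tensor K M N) = bilin K P (tensor_module K M N)"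
  "bilin K P Q (tensor K M N) = bilin K P Q (tensor_module K M N)"
  unfolding tensor_def tsum3_def[abs_def] bilin_def[abs_def] by (simp_all add: linear_update module_update)

lemma smash_simps [simp]:
  "carrier (smash K H A) = carrier (tensor_module K A H)"
  "add (smash K H A) = add (tensor_module K A H)"
  "zero (smash K H A) = zero (tensor_module K A H)"
  "smult (smash K H A) = smult (tensor_module K A H)"
  "module K (smash K H A) = module K (tensor_module K A H)"
  "tpure K (smash K H A) P = tpure K (tensor_module K A H) P"
  "tensor_module K (smash K H A) P = tensor_module K (tensor_module K A H) P"
  "tsum K (smash K H A) = tsum K (tensor_module K A H)"
  unfolding smash_def by (simp_all add: linear_update module_update)

subsection \<open>Tensor products of algebras\<close>

lemma assoc_algebra_bilin_mult:
  assumes "assoc_algebra K H" shows "bilin K H H H (mult H)"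
proof -
  interpret assoc_algebra K H by fact
  show ?thesis
    by (intro bilinI lin_homI) (auto simp: l_distr r_distr smult_mult_left smult_mult_right)
qed

context
  fixes K :: "('k, 'm) ring_scheme" and M :: "('k, 'a, 'p) module_scheme"
    and N :: "('k, 'b, 'q) module_scheme"
  assumes M: "assoc_algebra K M" and N: "assoc_algebra K N"
begin

interpretation M: assoc_algebra K M by (rule M)
interpretation N: assoc_algebra K N by (rule N)

abbreviation "TM \<equiv> tensor_module K M N"

lemmas mods = M.module_axioms N.module_axioms
lemmas TM = module_tensor_module[OF mods]
lemmas pure_closed = tpure_carrier[OF mods]
lemmas pure_bilin = bilin_tpure[OF mods]

lemma tensor_mult_eq:
  "mult (tensor K M N) = (\<lambda>t u. tsum K TM t (\<lambda>x y. tsum K TM u (\<lambda>x' y'.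
        tpure K M N (x \<otimes>\<^bsub>M\<^esub> x') (y \<otimes>\<^bsub>N\<^esub> y'))))"
  by (simp add: tensor_def)

lemma tensor_mult_inner1:
  assumes x: "x \<in> carrier M" and y: "y \<in> carrier N"
  shows "bilin K M N TM (\<lambda>x' y'. tpure K M N (x \<otimes>\<^bsub>M\<^esub> x') (y \<otimes>\<^bsub>N\<^esub> y'))"
  by (intro bilinI bilin_left[OF pure_bilin] bilin_right[OF pure_bilin]
      bilin_right[OF assoc_algebra_bilin_mult[OF M]] bilin_right[OF assoc_algebra_bilin_mult[OF N]]
      lin_hom_id x y M.m_closed N.m_closed)

text \<open>The companion with the second factor fixed: it supplies the linearity of the inner sum
  in the outer variables x and y.\<close>

lemma tensor_mult_inner2:
  assumes x: "x \<in> carrier M" and y: "y \<in> carrier N"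
  shows "bilin K M N TM (\<lambda>x' y'. tpure K M N (x' \<otimes>\<^bsub>M\<^esub> x) (y' \<otimes>\<^bsub>N\<^esub> y))"
  by (intro bilinI bilin_left[OF pure_bilin] bilin_right[OF pure_bilin]
      bilin_left[OF assoc_algebra_bilin_mult[OF M]] bilin_left[OF assoc_algebra_bilin_mult[OF N]]
      lin_hom_id x y M.m_closed N.m_closed)

lemma tensor_mult_outer:
  assumes u: "u \<in> carrier TM"
  shows "bilin K M N TM (\<lambda>x y. tsum K TM u (\<lambda>x' y'. tpure K M N (x \<otimes>\<^bsub>M\<^esub> x') (y \<otimes>\<^bsub>N\<^esub> y')))"
  using tensor_mult_inner2
  by (intro bilinI lin_hom_tsum_param[OF mods TM u] tensor_mult_inner1) (auto simp: bilin_def mods)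

lemma tensor_mult_bilin: "bilin K TM TM TM (mult (tensor K M N))"
  unfolding tensor_mult_eq
  by (intro bilinI lin_hom_tsum[OF mods TM tensor_mult_outer]
      lin_hom_tsum_param[OF mods TM] tensor_mult_outer lin_hom_tsum[OF mods TM]
      tensor_mult_inner1 TM)

lemma tensor_mult_pure:
  assumes "x \<in> carrier M" "y \<in> carrier N" "x' \<in> carrier M" "y' \<in> carrier N"
  shows "tpure K M N x y \<otimes>\<^bsub>tensor K M N\<^esub> tpure K M N x' y' = tpure K M N (x \<otimes>\<^bsub>M\<^esub> x') (y \<otimes>\<^bsub>N\<^esub> y')"
  using assms
  by (simp add: tensor_mult_eq tsum_tpure[OF mods TM tensor_mult_outer] pure_closed
      tsum_tpure[OF mods TM tensor_mult_inner1])

lemma tensor_one: "\<one>\<^bsub>tensor K M N\<^esub> = tpure K M N \<one>\<^bsub>M\<^esub> \<one>\<^bsub>N\<^esub>"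
  by (simp add: tensor_def)

text \<open>Associativity is trilinear in t, u, v, so the three are made pure one after the other
  while the remaining ones stay arbitrary.\<close>

lemma assoc_algebra_tensor: "assoc_algebra K (tensor K M N)"
proof -
  note B = tensor_mult_bilin
  note L = bilin_left[OF B] bilin_right[OF B] lin_hom_id
  interpret T: module K TM by (rule TM)
  have cl: "t \<otimes>\<^bsub>tensor K M N\<^esub> u \<in> carrier TM" if "t \<in> carrier TM" "u \<in> carrier TM" for t u
    using bilin_closed[OF B] that by simp
  have assoc: "t \<otimes>\<^bsub>tensor K M N\<^esub> u \<otimes>\<^bsub>tensor K M N\<^esub> v = t \<otimes>\<^bsub>tensor K M N\<^esub> (u \<otimes>\<^bsub>tensor K M N\<^esub> v)"
    if t: "t \<in> carrier TM" and u: "u \<in> carrier TM" and v: "v \<in> carrier TM" for t u v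
  proof (rule lin_hom_tensor_eqI[OF mods _ _ TM _ t])
    fix x y assume xy: "x \<in> carrier M" "y \<in> carrier N"
    show "tpure K M N x y \<otimes>\<^bsub>tensor K M N\<^esub> u \<otimes>\<^bsub>tensor K M N\<^esub> v
        = tpure K M N x y \<otimes>\<^bsub>tensor K M N\<^esub> (u \<otimes>\<^bsub>tensor K M N\<^esub> v)"
    proof (rule lin_hom_tensor_eqI[OF mods _ _ TM _ u])
      fix x' y' assume xy': "x' \<in> carrier M" "y' \<in> carrier N"
      show "tpure K M N x y \<otimes>\<^bsub>tensor K M N\<^esub> tpure K M N x' y' \<otimes>\<^bsub>tensor K M N\<^esub> v
        = tpure K M N x y \<otimes>\<^bsub>tensor K M N\<^esub> (tpure K M N x' y' \<otimes>\<^bsub>tensor K M N\<^esub> v)"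
        by (rule lin_hom_tensor_eqI[OF mods _ _ TM _ v])
          (intro L cl pure_closed xy xy'
            | simp add: tensor_mult_pure xy xy' pure_closed M.m_assoc N.m_assoc)+
    qed (intro L cl pure_closed xy v)+
  qed (intro L cl u v)+
  have one: "\<one>\<^bsub>tensor K M N\<^esub> \<in> carrier TM" by (simp add: tensor_one pure_closed)
  have l_one: "\<one>\<^bsub>tensor K M N\<^esub> \<otimes>\<^bsub>tensor K M N\<^esub> t = t" if t: "t \<in> carrier TM" for t
    by (rule lin_hom_tensor_eqI[OF mods _ _ TM _ t])
      (intro L one | simp add: tensor_one tensor_mult_pure)+
  have r_one: "t \<otimes>\<^bsub>tensor K M N\<^esub> \<one>\<^bsub>tensor K M N\<^esub> = t" if t: "t \<in> carrier TM" for t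
    by (rule lin_hom_tensor_eqI[OF mods _ _ TM _ t])
      (intro L one | simp add: tensor_one tensor_mult_pure)+
  have mT: "module K (tensor K M N)" using TM by simp
  have rT: "ring (tensor K M N)"
  proof (rule ringI)
    show "abelian_group (tensor K M N)" using mT by (simp add: module_def)
    show "monoid (tensor K M N)"
      by (rule monoidI) (simp_all add: cl assoc one l_one r_one)
  qed (use lin_hom_add[OF bilin_left[OF B lin_hom_id]] lin_hom_add[OF bilin_right[OF B _ lin_hom_id]]
      in simp_all)
  show ?thesis
    by (intro assoc_algebra.intro assoc_algebra_axioms.intro mT rT M.K.field_axioms)
      (use lin_hom_smult[OF bilin_left[OF B lin_hom_id]] lin_hom_smult[OF bilin_right[OF B _ lin_hom_id]]
        in simp_all)
qed

end

lemma ring_hom_tensorI: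
  assumes M: "assoc_algebra K M" and N: "assoc_algebra K N" and P: "assoc_algebra K P"
    and f: "f \<in> lin_hom K (tensor_module K M N) P"
    and one: "f (tpure K M N \<one>\<^bsub>M\<^esub> \<one>\<^bsub>N\<^esub>) = \<one>\<^bsub>P\<^esub>"
    and mult: "\<And>x y x' y'. \<lbrakk>x \<in> carrier M; y \<in> carrier N; x' \<in> carrier M; y' \<in> carrier N\<rbrakk> \<Longrightarrow>
      f (tpure K M N (x \<otimes>\<^bsub>M\<^esub> x') (y \<otimes>\<^bsub>N\<^esub> y')) = f (tpure K M N x y) \<otimes>\<^bsub>P\<^esub> f (tpure K M N x' y')"
  shows "f \<in> ring_hom (tensor K M N) P"
proof (rule ring_hom_memI)
  have mods: "module K M" "module K N" "module K P"
    using M N P by (simp_all add: assoc_algebra_def)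
  note T = tensor_mult_bilin[OF M N] and PB = assoc_algebra_bilin_mult[OF P]
  fix t u assume "t \<in> carrier (tensor K M N)" "u \<in> carrier (tensor K M N)"
  hence t: "t \<in> carrier (tensor_module K M N)" and u: "u \<in> carrier (tensor_module K M N)" by auto
  show "f (t \<otimes>\<^bsub>tensor K M N\<^esub> u) = f t \<otimes>\<^bsub>P\<^esub> f u"
  proof (rule lin_hom_tensor_eqI[OF mods(1,2) _ _ mods(3) _ t])
    fix x y assume xy: "x \<in> carrier M" "y \<in> carrier N"
    note p = tpure_carrier[OF mods(1,2) xy]
    show "f (tpure K M N x y \<otimes>\<^bsub>tensor K M N\<^esub> u) = f (tpure K M N x y) \<otimes>\<^bsub>P\<^esub> f u"
      by (rule lin_hom_tensor_eqI[OF mods(1,2) lin_hom_compose[OF f bilin_right[OF T p lin_hom_id]]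
            bilin_right[OF PB lin_hom_closed[OF f p] f] mods(3) _ u])
        (simp add: tensor_mult_pure[OF M N] xy mult)
  qed (intro lin_hom_compose[OF f] bilin_left[OF T] bilin_left[OF PB] lin_hom_id f u lin_hom_closed[OF f])+
qed (use lin_hom_closed[OF f] lin_hom_add[OF f] one in \<open>auto simp: tensor_one[OF M N]\<close>)

section \<open>Tensor products of linear maps\<close>

definition tmap ::
  "('k, 'm) ring_scheme \<Rightarrow> ('k, 'c, 'p) module_scheme \<Rightarrow> ('k, 'd, 'q) module_scheme
    \<Rightarrow> ('a \<Rightarrow> 'c) \<Rightarrow> ('b \<Rightarrow> 'd) \<Rightarrow> ('k, 'a, 'b) tens \<Rightarrow> ('k, 'c, 'd) tens" where
  "tmap K M' N' f g t = tsum K (tensor_module K M' N') t (\<lambda>x y. tpure K M' N' (f x) (g y))"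

context
  fixes K :: "('k, 'm) ring_scheme" and M :: "('k, 'a, 'p) module_scheme"
    and N :: "('k, 'b, 'q) module_scheme" and M' :: "('k, 'c, 'r) module_scheme"
    and N' :: "('k, 'd, 's) module_scheme" and f :: "'a \<Rightarrow> 'c" and g :: "'b \<Rightarrow> 'd"
  assumes mods: "module K M" "module K N" "module K M'" "module K N'"
    and f: "f \<in> lin_hom K M M'" and g: "g \<in> lin_hom K N N'"
begin

lemma tmap_bilin: "bilin K M N (tensor_module K M' N') (\<lambda>x y. tpure K M' N' (f x) (g y))"
  by (intro bilinI bilin_left[OF bilin_tpure] bilin_right[OF bilin_tpure] mods f g
      lin_hom_closed[OF f] lin_hom_closed[OF g])

lemma tmap_linear: "tmap K M' N' f g \<in> lin_hom K (tensor_module K M N) (tensor_module K M' N')"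
  unfolding tmap_def[abs_def]
  by (intro lin_hom_tsum tmap_bilin mods module_tensor_module)

lemma tmap_pure:
  "x \<in> carrier M \<Longrightarrow> y \<in> carrier N \<Longrightarrow> tmap K M' N' f g (tpure K M N x y) = tpure K M' N' (f x) (g y)"
  unfolding tmap_def by (intro tsum_tpure tmap_bilin mods module_tensor_module)

end

lemma tmap_ring_hom:
  assumes A: "assoc_algebra K M" "assoc_algebra K N" "assoc_algebra K M'" "assoc_algebra K N'"
    and f: "f \<in> lin_hom K M M'" "f \<in> ring_hom M M'"
    and g: "g \<in> lin_hom K N N'" "g \<in> ring_hom N N'"
  shows "tmap K M' N' f g \<in> ring_hom (tensor K M N) (tensor K M' N')"
proof -
  interpret M: assoc_algebra K M by fact
  interpret N: assoc_algebra K N by fact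
  have mods: "module K M" "module K N" "module K M'" "module K N'"
    using A by (simp_all add: assoc_algebra_def)
  note lin = tmap_linear[OF mods f(1) g(1)] and pure = tmap_pure[OF mods f(1) g(1)]
  show ?thesis
    by (rule ring_hom_tensorI[OF A(1,2) assoc_algebra_tensor[OF A(3,4)]])
      (simp_all add: lin pure ring_hom_one[OF f(2)] ring_hom_one[OF g(2)]
        ring_hom_mult[OF f(2)] ring_hom_mult[OF g(2)] tensor_one[OF A(3,4)]
        tensor_mult_pure[OF A(3,4)] ring_hom_closed[OF f(2)] ring_hom_closed[OF g(2)])
qed

section \<open>Counit identities in a quasi-bialgebra\<close>

context quasi_bialgebra
begin

abbreviation "T2 \<equiv> tensor_module K H H"
abbreviation "T3 \<equiv> tensor_module K H T2"
abbreviation "T4 \<equiv> tensor_module K H T3"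
abbreviation "A2 \<equiv> tensor K H H"
abbreviation "A3 \<equiv> tensor K H A2"
abbreviation "A4 \<equiv> tensor K H A3"
abbreviation "p2 \<equiv> tpure K H H"
abbreviation "p3 x y z \<equiv> tpure K H T2 x (p2 y z)"
abbreviation "p4 x y z w \<equiv> tpure K H T3 x (p3 y z w)"

lemma module_H [simp]: "module K H" by (rule module_axioms)
lemma algebra_H [simp]: "assoc_algebra K H" by (rule assoc_algebra_axioms)

declare module_tensor_module [simp] assoc_algebra_tensor [simp] tpure_carrier [simp]

lemma counit_closed [simp]: "h \<in> carrier H \<Longrightarrow> counit H h \<in> carrier K"
  using counit_ring_hom ring_hom_closed by metis

lemma counit_one [simp]: "counit H \<one> = \<one>\<^bsub>K\<^esub>"
  using counit_ring_hom ring_hom_one by metis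

lemma counit_mult [simp]:
  "h \<in> carrier H \<Longrightarrow> g \<in> carrier H \<Longrightarrow> counit H (h \<otimes> g) = counit H h \<otimes>\<^bsub>K\<^esub> counit H g"
  using counit_ring_hom ring_hom_mult by metis

lemma comul_closed [simp]: "h \<in> carrier H \<Longrightarrow> comul H h \<in> carrier T2"
  using comul_linear by (auto simp: lin_hom_def)

lemma comul_lin [simp]: "comul H \<in> lin_hom K H T2"
  using comul_linear by simp

lemma comul_one [simp]: "comul H \<one> = p2 \<one> \<one>"
  using ring_hom_one[OF comul_ring_hom] by (simp add: tensor_one[of K])

lemma reassoc_closed [simp]: "reassoc H \<in> carrier T3"
  using reassoc_unit by (auto simp: Units_def)

lemma ring_A: "ring A2" "ring A3" "ring A4"
  by (simp_all add: assoc_algebra.axioms(3)[where K = K])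

lemma reassoc_inv_closed [simp]: "reassoc_inv K H \<in> carrier T3"
  using monoid.Units_inv_closed[OF ring.is_monoid[OF ring_A(2)] reassoc_unit]
  by (simp add: reassoc_inv_def)

lemma reassoc_inv_l [simp]: "reassoc_inv K H \<otimes>\<^bsub>A3\<^esub> reassoc H = \<one>\<^bsub>A3\<^esub>"
  using monoid.Units_l_inv[OF ring.is_monoid[OF ring_A(2)] reassoc_unit]
  by (simp add: reassoc_inv_def)

lemma reassoc_inv_r [simp]: "reassoc H \<otimes>\<^bsub>A3\<^esub> reassoc_inv K H = \<one>\<^bsub>A3\<^esub>"
  using monoid.Units_r_inv[OF ring.is_monoid[OF ring_A(2)] reassoc_unit]
  by (simp add: reassoc_inv_def)

lemma one_A [simp]: "\<one>\<^bsub>A2\<^esub> = p2 \<one> \<one>" "\<one>\<^bsub>A3\<^esub> = p3 \<one> \<one> \<one>" "\<one>\<^bsub>A4\<^esub> = p4 \<one> \<one> \<one> \<one>"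
  by (simp_all add: tensor_one[of K])

lemma mult_A2 [simp]:
  "\<lbrakk>x \<in> carrier H; y \<in> carrier H; x' \<in> carrier H; y' \<in> carrier H\<rbrakk> \<Longrightarrow>
    p2 x y \<otimes>\<^bsub>A2\<^esub> p2 x' y' = p2 (x \<otimes> x') (y \<otimes> y')"
  by (simp add: tensor_mult_pure)

lemma mult_A3 [simp]:
  "\<lbrakk>x \<in> carrier H; y \<in> carrier T2; x' \<in> carrier H; y' \<in> carrier T2\<rbrakk> \<Longrightarrow>
    tpure K H T2 x y \<otimes>\<^bsub>A3\<^esub> tpure K H T2 x' y' = tpure K H T2 (x \<otimes> x') (y \<otimes>\<^bsub>A2\<^esub> y')"
  using tensor_mult_pure[of K H A2 x y x' y'] by simp

lemma mult_A4 [simp]: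
  "\<lbrakk>x \<in> carrier H; y \<in> carrier T3; x' \<in> carrier H; y' \<in> carrier T3\<rbrakk> \<Longrightarrow>
    tpure K H T3 x y \<otimes>\<^bsub>A4\<^esub> tpure K H T3 x' y' = tpure K H T3 (x \<otimes> x') (y \<otimes>\<^bsub>A3\<^esub> y')"
  using tensor_mult_pure[of K H A3 x y x' y'] by simp

lemma bilin_A [simp]:
  "bilin K T2 T2 T2 (mult A2)" "bilin K T3 T3 T3 (mult A3)" "bilin K T4 T4 T4 (mult A4)"
  using assoc_algebra_bilin_mult[of K A2] assoc_algebra_bilin_mult[of K A3]
    assoc_algebra_bilin_mult[of K A4] by simp_all

lemma mult_A_closed [simp]:
  "t \<in> carrier T2 \<Longrightarrow> u \<in> carrier T2 \<Longrightarrow> t \<otimes>\<^bsub>A2\<^esub> u \<in> carrier T2"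
  "t' \<in> carrier T3 \<Longrightarrow> u' \<in> carrier T3 \<Longrightarrow> t' \<otimes>\<^bsub>A3\<^esub> u' \<in> carrier T3"
  "t'' \<in> carrier T4 \<Longrightarrow> u'' \<in> carrier T4 \<Longrightarrow> t'' \<otimes>\<^bsub>A4\<^esub> u'' \<in> carrier T4"
  by (simp_all add: bilin_closed[OF bilin_A(1)] bilin_closed[OF bilin_A(2)] bilin_closed[OF bilin_A(3)])

lemma bilin_mult_H: "bilin K H H H (mult H)"
  by (simp add: assoc_algebra_bilin_mult)

text \<open>\<open>K\<close> is a ring record and not a module record, so \<epsilon> itself cannot
  belong to a \<open>lin_hom\<close>. Its linearity is stated through the scalar multiple that it
  produces.\<close>

lemma lin_hom_counit [simp]:
  assumes "module K P" "f \<in> lin_hom K Q H" "y \<in> carrier P"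
  shows "(\<lambda>x. counit H (f x) \<odot>\<^bsub>P\<^esub> y) \<in> lin_hom K Q P"
proof -
  interpret P: module K P by fact
  show ?thesis using lin_homD[OF assms(2)] assms(3) ring_hom_add[OF counit_ring_hom]
    by (intro lin_homI) (simp_all add: counit_smult P.smult_l_distr P.smult_assoc1)
qed

text \<open>As conditional rewrite rules these are directed by the head symbol under the abstraction,
  so \<open>simp\<close> proves the multilinearity of nested Sweedler sums.\<close>

lemmas lin_base =
  lin_hom_id bilin_left[OF bilin_tpure] bilin_right[OF bilin_tpure]
  bilin_left[OF bilin_mult_H] bilin_right[OF bilin_mult_H]
  bilin_left[OF bilin_A(1)] bilin_right[OF bilin_A(1)]
  bilin_left[OF bilin_A(2)] bilin_right[OF bilin_A(2)]
  bilin_left[OF bilin_A(3)] bilin_right[OF bilin_A(3)]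
  lin_hom_scale lin_hom_counit lin_hom_compose[OF comul_lin]
  lin_hom_compose[OF lin_hom_tsum[of K H H]] lin_hom_tsum_param[of K H H]
  lin_hom_compose[OF lin_hom_tsum[of K H T2]] lin_hom_tsum_param[of K H T2]
  bilinI

declare lin_base [simp]

lemma tsum_closed [simp]:
  "\<lbrakk>module K P; bilin K H H P F; t \<in> carrier T2\<rbrakk> \<Longrightarrow> tsum K P t F \<in> carrier P"
  by (rule tsum_carrier[of K H H]) auto

declare tsum_tpure [simp]

lemma ext3:
  assumes "f \<in> lin_hom K T3 P" "g \<in> lin_hom K T3 P" "module K P" "t \<in> carrier T3"
    and eq: "\<And>x y z. \<lbrakk>x \<in> carrier H; y \<in> carrier H; z \<in> carrier H\<rbrakk> \<Longrightarrow> f (p3 x y z) = g (p3 x y z)"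
  shows "f t = g t"
proof (rule lin_hom_tensor_eqI[of K H T2, OF _ _ assms(1,2,3) _ assms(4)])
  fix x u assume x: "x \<in> carrier H" and u: "u \<in> carrier T2"
  show "f (tpure K H T2 x u) = g (tpure K H T2 x u)"
    by (rule lin_hom_tensor_eqI[of K H H, OF _ _ _ _ assms(3) _ u])
      (simp_all add: x eq lin_hom_compose[OF assms(1)] lin_hom_compose[OF assms(2)])
qed simp_all

end

lemma tmap_tensor [simp]:
  "tmap K (tensor K M N) P = tmap K (tensor_module K M N) P"
  "tmap K P (tensor K M N) = tmap K P (tensor_module K M N)"
  by (intro ext; simp add: tmap_def)+

text \<open>The map \<epsilon> \<otimes> id followed by the identification of k \<otimes> N with
  N.\<close>

definition eps_left ::
  "('k, 'm) ring_scheme \<Rightarrow> ('k, 'h, 'p) quasi_bialgebra_scheme \<Rightarrow> ('k, 'b, 'q) module_scheme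
    \<Rightarrow> ('k, 'h, 'b) tens \<Rightarrow> 'b" where
  "eps_left K H N t = tsum K N t (\<lambda>x y. counit H x \<odot>\<^bsub>N\<^esub> y)"

lemma eps_left_tensor [simp]: "eps_left K H (tensor K M N) = eps_left K H (tensor_module K M N)"
  by (intro ext) (simp add: eps_left_def)

context quasi_bialgebra
begin

declare tsum3_def [simp]

lemma eps_left_bilin: "module K N \<Longrightarrow> bilin K H N N (\<lambda>x y. counit H x \<odot>\<^bsub>N\<^esub> y)"
  by simp

lemma eps_left_lin [simp]: "module K N \<Longrightarrow> eps_left K H N \<in> lin_hom K (tensor_module K H N) N"
  unfolding eps_left_def[abs_def] by (intro lin_hom_tsum eps_left_bilin) auto

lemma eps_left_pure [simp]:
  "module K N \<Longrightarrow> x \<in> carrier H \<Longrightarrow> y \<in> carrier N \<Longrightarrow>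
    eps_left K H N (tpure K H N x y) = counit H x \<odot>\<^bsub>N\<^esub> y"
  unfolding eps_left_def by simp

text \<open>The map is multiplicative because \<epsilon> is and because scalars move freely through
  products in N.\<close>

lemma eps_left_ring_hom [simp]:
  assumes N: "assoc_algebra K N" shows "eps_left K H N \<in> ring_hom (tensor K H N) N"
proof -
  interpret N: assoc_algebra K N by fact
  have m: "module K N" by (rule N.module_axioms)
  have comm: "c \<odot>\<^bsub>N\<^esub> (d \<odot>\<^bsub>N\<^esub> y) = d \<odot>\<^bsub>N\<^esub> (c \<odot>\<^bsub>N\<^esub> y)"
    if "c \<in> carrier K" "d \<in> carrier K" "y \<in> carrier N" for c d y
    using that by (simp add: N.smult_assoc1[symmetric] K.m_comm)
  show ?thesis
    by (rule ring_hom_tensorI[OF algebra_H N N eps_left_lin[OF m]])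
      (simp_all add: m N.smult_mult_left N.smult_mult_right N.smult_assoc1 comm)
qed

lemma id_ring_hom [simp]: "(\<lambda>x. x) \<in> ring_hom H H"
  by (auto simp: ring_hom_def)

lemma counit_unit_ring_hom [simp]: "(\<lambda>z. counit H z \<odot> \<one>) \<in> ring_hom H H"
  using ring_hom_add[OF counit_ring_hom]
  by (intro ring_hom_memI)
    (simp_all add: smult_l_distr smult_mult_left smult_assoc1)

lemma pure_one_ring_hom [simp]: "(\<lambda>z. p2 z \<one>) \<in> ring_hom H A2"
  by (intro ring_hom_memI) (simp_all add: lin_hom_add[of "\<lambda>z. p2 z \<one>" K H])

text \<open>\<open>eps1\<close>, \<open>eps2\<close> remove a slot of \<open>H \<otimes> H \<otimes> H\<close> by \<open>\<epsilon>\<close>, \<open>Eps2\<close>, \<open>Eps3\<close> one of \<open>H \<otimes> H \<otimes> H \<otimes> H\<close>,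
  while \<open>eps3\<close> keeps the slot as a multiple of \<open>1\<close>; \<open>com\<^sub>i\<close> comultiplies slot \<open>i\<close>, \<open>emb1 t = 1 \<otimes> t\<close>
  and \<open>emb4 t = t \<otimes> 1\<close>.\<close>

definition "eps1 = eps_left K H T2"
definition "eps2 = tmap K H H (\<lambda>x. x) (eps_left K H H)"
definition "eps3 = tmap K H T2 (\<lambda>x. x) (tmap K H H (\<lambda>x. x) (\<lambda>z. counit H z \<odot> \<one>))"
definition "Eps2 = tmap K H T2 (\<lambda>x. x) eps1"
definition "Eps3 = tmap K H T2 (\<lambda>x. x) eps2"
definition "emb1 = (\<lambda>t. tpure K H T3 \<one> t)"
definition "emb4 = tmap K H T3 (\<lambda>x. x) (tmap K H T2 (\<lambda>x. x) (\<lambda>z. p2 z \<one>))"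
definition "com3 = tmap K H T3 (\<lambda>x. x) (tmap K H T2 (\<lambda>x. x) (comul H))"
definition "com1 t = tsum3 K T4 t (\<lambda>x y z. tsum K T4 (comul H x) (\<lambda>x1 x2. p4 x1 x2 y z))"
definition "com2 t = tsum3 K T4 t (\<lambda>x y z. tsum K T4 (comul H y) (\<lambda>y1 y2. p4 x y1 y2 z))"

lemma slots_lin [simp]:
  "eps1 \<in> lin_hom K T3 T2" "eps2 \<in> lin_hom K T3 T2" "eps3 \<in> lin_hom K T3 T3"
  "Eps2 \<in> lin_hom K T4 T3" "Eps3 \<in> lin_hom K T4 T3" "emb1 \<in> lin_hom K T3 T4"
  "emb4 \<in> lin_hom K T3 T4" "com3 \<in> lin_hom K T3 T4" "com1 \<in> lin_hom K T3 T4" "com2 \<in> lin_hom K T3 T4"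
proof -
  show e: "eps1 \<in> lin_hom K T3 T2" "eps2 \<in> lin_hom K T3 T2" "eps3 \<in> lin_hom K T3 T3"
    by (simp_all add: eps1_def eps2_def eps3_def tmap_linear)
  show "Eps2 \<in> lin_hom K T4 T3" "Eps3 \<in> lin_hom K T4 T3"
    by (simp_all add: Eps2_def Eps3_def tmap_linear e)
  show "emb1 \<in> lin_hom K T3 T4" by (simp add: emb1_def)
  show "emb4 \<in> lin_hom K T3 T4" "com3 \<in> lin_hom K T3 T4"
    by (simp_all add: emb4_def com3_def tmap_linear)
  show "com1 \<in> lin_hom K T3 T4" "com2 \<in> lin_hom K T3 T4"
    unfolding com1_def[abs_def] com2_def[abs_def] by simp_all
qed

lemmas slots_closed [simp] = slots_lin[THEN lin_hom_closed]
lemmas slots_lin_compose [simp] = slots_lin[THEN lin_hom_compose]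

lemma slots_pure [simp]:
  assumes "x \<in> carrier H" "y \<in> carrier H" "z \<in> carrier H"
  shows "eps1 (p3 x y z) = counit H x \<odot>\<^bsub>T2\<^esub> p2 y z"
    "eps2 (p3 x y z) = p2 x (counit H y \<odot> z)"
    "eps3 (p3 x y z) = p3 x y (counit H z \<odot> \<one>)"
    "w \<in> carrier H \<Longrightarrow> Eps2 (p4 w x y z) = tpure K H T2 w (counit H x \<odot>\<^bsub>T2\<^esub> p2 y z)"
    "w \<in> carrier H \<Longrightarrow> Eps3 (p4 w x y z) = p3 w x (counit H y \<odot> z)"
    "emb4 (p3 x y z) = p4 x y z \<one>"
    "com3 (p3 x y z) = tpure K H T3 x (tpure K H T2 y (comul H z))"
    "com1 (p3 x y z) = tsum K T4 (comul H x) (\<lambda>x1 x2. p4 x1 x2 y z)"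
    "com2 (p3 x y z) = tsum K T4 (comul H y) (\<lambda>y1 y2. p4 x y1 y2 z)"
  using assms
  by (simp_all add: eps1_def eps2_def eps3_def Eps2_def Eps3_def emb4_def com3_def com1_def com2_def
      tmap_pure tmap_linear)

text \<open>These are the maps that get applied to products: the counit maps to both sides of the
  pentagon or to \<Phi>\<inverse>\<Phi>, and \<open>emb4\<close>, \<open>com3\<close> to
  \<Phi>\<Phi>\<inverse> and \<Phi>\<inverse>\<Phi> when the pentagon is solved for one of its
  factors.\<close>

lemma slots_ring_hom:
  "eps1 \<in> ring_hom A3 A2" "eps2 \<in> ring_hom A3 A2" "eps3 \<in> ring_hom A3 A3"
  "Eps2 \<in> ring_hom A4 A3" "Eps3 \<in> ring_hom A4 A3"
  "emb4 \<in> ring_hom A3 A4" "com3 \<in> ring_hom A3 A4"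
proof -
  note h = tmap_ring_hom[of K H, OF algebra_H _ _ _ lin_hom_id id_ring_hom]
  show e1: "eps1 \<in> ring_hom A3 A2" using eps_left_ring_hom[of A2] by (simp add: eps1_def)
  show e2: "eps2 \<in> ring_hom A3 A2" using h[of A2 H "eps_left K H H"] by (simp add: eps2_def)
  show "Eps2 \<in> ring_hom A4 A3" using h[of A3 A2 eps1] e1 by (simp add: Eps2_def)
  show "Eps3 \<in> ring_hom A4 A3" using h[of A3 A2 eps2] e2 by (simp add: Eps3_def)
  have "tmap K H H (\<lambda>x. x) (\<lambda>z. counit H z \<odot> \<one>) \<in> ring_hom A2 A2"
    using h[of H H "\<lambda>z. counit H z \<odot> \<one>"] by simp
  thus "eps3 \<in> ring_hom A3 A3"
    using h[of A2 A2 "tmap K H H (\<lambda>x. x) (\<lambda>z. counit H z \<odot> \<one>)"] by (simp add: eps3_def tmap_linear)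
  have "tmap K H T2 (\<lambda>x. x) (\<lambda>z. p2 z \<one>) \<in> ring_hom A2 A3"
    using h[of H A2 "\<lambda>z. p2 z \<one>"] by simp
  thus "emb4 \<in> ring_hom A3 A4"
    using h[of A2 A3 "tmap K H T2 (\<lambda>x. x) (\<lambda>z. p2 z \<one>)"] by (simp add: emb4_def tmap_linear)
  have "tmap K H T2 (\<lambda>x. x) (comul H) \<in> ring_hom A2 A3"
    using h[of H A2 "comul H"] comul_ring_hom by simp
  thus "com3 \<in> ring_hom A3 A4"
    using h[of A2 A3 "tmap K H T2 (\<lambda>x. x) (comul H)"] by (simp add: com3_def tmap_linear)
qed

lemma pentagon_slots:
  "emb1 (reassoc H) \<otimes>\<^bsub>A4\<^esub> com2 (reassoc H) \<otimes>\<^bsub>A4\<^esub> emb4 (reassoc H)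
    = com3 (reassoc H) \<otimes>\<^bsub>A4\<^esub> com1 (reassoc H)"
proof -
  have 1: "emb4 (reassoc H) = tsum3 K T4 (reassoc H) (\<lambda>X1 X2 X3. p4 X1 X2 X3 \<one>)"
    by (rule ext3[where P = T4]) simp_all
  have 2: "com3 (reassoc H)
      = tsum3 K T4 (reassoc H) (\<lambda>X1 X2 X3. tpure K H T3 X1 (tpure K H T2 X2 (comul H X3)))"
    by (rule ext3[where P = T4]) simp_all
  show ?thesis
    using pentagon unfolding 1 2 by (simp add: emb1_def com1_def com2_def)
qed

lemma tpure_smult [simp]:
  assumes "module K M" "module K N" "c \<in> carrier K" "x \<in> carrier M" "y \<in> carrier N"
  shows "tpure K M N (c \<odot>\<^bsub>M\<^esub> x) y = c \<odot>\<^bsub>tensor_module K M N\<^esub> tpure K M N x y"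
    "tpure K M N x (c \<odot>\<^bsub>N\<^esub> y) = c \<odot>\<^bsub>tensor_module K M N\<^esub> tpure K M N x y"
  using assms lin_hom_smult[OF bilin_left[OF bilin_tpure lin_hom_id]]
    lin_hom_smult[OF bilin_right[OF bilin_tpure _ lin_hom_id]] by metis+

lemma smult_in_carrier [simp]:
  "module K M \<Longrightarrow> c \<in> carrier K \<Longrightarrow> x \<in> carrier M \<Longrightarrow> c \<odot>\<^bsub>M\<^esub> x \<in> carrier M"
  by (rule module.smult_closed)

lemma one_smult [simp]: "module K M \<Longrightarrow> x \<in> carrier M \<Longrightarrow> \<one>\<^bsub>K\<^esub> \<odot>\<^bsub>M\<^esub> x = x"
  by (rule module.smult_one)

text \<open>Linear maps move through Sweedler sums. The new summand G is a parameter compared with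
  f(F x y) on the carrier only, so the same step may also rewrite the summand.\<close>

lemma tsum_push:
  assumes "f \<in> lin_hom K P P'" "module K P" "module K P'" "t \<in> carrier T2"
    and "bilin K H H P F" "bilin K H H P' G"
    and "\<And>x y. x \<in> carrier H \<Longrightarrow> y \<in> carrier H \<Longrightarrow> f (F x y) = G x y"
  shows "f (tsum K P t F) = tsum K P' t G"
  by (rule lin_hom_tensor_eqI[of K H H, OF _ _ lin_hom_compose[OF assms(1) lin_hom_tsum] lin_hom_tsum])
    (simp_all add: assms)

lemma tsum_counit_right:
  assumes "module K P" "L \<in> lin_hom K H P" "h \<in> carrier H"
  shows "tsum K P (comul H h) (\<lambda>h1 h2. counit H h2 \<odot>\<^bsub>P\<^esub> L h1) = L h"
proof -
  have "L (tsum K H (comul H h) (\<lambda>h1 h2. counit H h2 \<odot> h1))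
      = tsum K P (comul H h) (\<lambda>h1 h2. counit H h2 \<odot>\<^bsub>P\<^esub> L h1)"
    by (rule tsum_push) (simp_all add: assms lin_homD[OF assms(2)])
  thus ?thesis using assms by (simp add: counit_right)
qed

lemma tsum_counit_left:
  assumes "module K P" "L \<in> lin_hom K H P" "h \<in> carrier H"
  shows "tsum K P (comul H h) (\<lambda>h1 h2. counit H h1 \<odot>\<^bsub>P\<^esub> L h2) = L h"
proof -
  have "L (tsum K H (comul H h) (\<lambda>h1 h2. counit H h1 \<odot> h2))
      = tsum K P (comul H h) (\<lambda>h1 h2. counit H h1 \<odot>\<^bsub>P\<^esub> L h2)"
    by (rule tsum_push) (simp_all add: assms lin_homD[OF assms(2)])
  thus ?thesis using assms by (simp add: counit_left)
qed

lemma A3_one [simp]: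
  "t \<in> carrier T3 \<Longrightarrow> t \<otimes>\<^bsub>A3\<^esub> p3 \<one> \<one> \<one> = t"
  "t \<in> carrier T3 \<Longrightarrow> p3 \<one> \<one> \<one> \<otimes>\<^bsub>A3\<^esub> t = t"
  using monoid.r_one[OF ring.is_monoid[OF ring_A(2)], of t]
    monoid.l_one[OF ring.is_monoid[OF ring_A(2)], of t] by simp_all

lemma Eps_tpure [simp]:
  assumes "x \<in> carrier H"
  shows "t \<in> carrier T3 \<Longrightarrow> Eps2 (tpure K H T3 x t) = tpure K H T2 x (eps1 t)"
    "t \<in> carrier T3 \<Longrightarrow> Eps3 (tpure K H T3 x t) = tpure K H T2 x (eps2 t)"
    "u \<in> carrier T2 \<Longrightarrow> eps1 (tpure K H T2 x u) = counit H x \<odot>\<^bsub>T2\<^esub> u"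
    "u \<in> carrier T2 \<Longrightarrow> eps2 (tpure K H T2 x u) = p2 x (eps_left K H H u)"
  using assms by (simp_all add: Eps2_def Eps3_def tmap_pure tmap_linear)
    (simp_all add: eps1_def eps2_def tmap_pure)

lemma eps_left_comul [simp]: "h \<in> carrier H \<Longrightarrow> eps_left K H H (comul H h) = h"
  by (simp add: eps_left_def counit_left)

section \<open>Trivial counit contractions of the reassociator and its inverse\<close>

lemma eps2_reassoc: "eps2 (reassoc H) = p2 \<one> \<one>"
proof -
  have "eps2 (reassoc H) = tsum3 K T2 (reassoc H) (\<lambda>X1 X2 X3. p2 X1 (counit H X2 \<odot> X3))"
    by (rule ext3[where P = T2]) simp_all
  thus ?thesis using reassoc_counit by simp
qed

text \<open>With \<epsilon> in the third slot of the pentagon, \<open>com2\<close> and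
  \<open>com3\<close> lose half of a coproduct and return \<Phi>, while \<open>emb1\<close> and
  \<open>com1\<close> only see \<epsilon> in the middle slot of \<Phi> and become 1. What remains is
  \<Phi> times \<open>eps3\<close> of \<Phi> equal to \<Phi>, and \<Phi> cancels. The factor 1 in
  the last slot of \<open>emb4\<close> is why \<open>eps3\<close> keeps a multiple of 1
  there.\<close>

lemma eps3_reassoc: "eps3 (reassoc H) = p3 \<one> \<one> \<one>"
proof -
  have com2: "Eps3 (com2 (reassoc H)) = reassoc H"
  proof (rule ext3[where P = T3])
    fix x y z assume xyz: "x \<in> carrier H" "y \<in> carrier H" "z \<in> carrier H"
    have "Eps3 (com2 (p3 x y z)) = tsum K T3 (comul H y) (\<lambda>y1 y2. counit H y2 \<odot>\<^bsub>T3\<^esub> p3 x y1 z)"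
      by (subst slots_pure[OF xyz], rule tsum_push[where P = T4]) (simp_all add: xyz)
    also have "\<dots> = p3 x y z" by (rule tsum_counit_right) (simp_all add: xyz)
    finally show "Eps3 (com2 (p3 x y z)) = p3 x y z" .
  qed simp_all
  have emb4: "Eps3 (emb4 (reassoc H)) = eps3 (reassoc H)"
    by (rule ext3[where P = T3]) simp_all
  have com3: "Eps3 (com3 (reassoc H)) = reassoc H"
    by (rule ext3[where P = T3]) simp_all
  \<comment> \<open>Writing the right side as a function of \<open>eps2 (reassoc H)\<close> lets the
    counit axiom be substituted for the whole reassociator.\<close>
  have "Eps3 (com1 (reassoc H)) = tsum K T3 (eps2 (reassoc H))
      (\<lambda>x v. tsum K T3 (comul H x) (\<lambda>x1 x2. p3 x1 x2 v))"
  proof (rule ext3[where P = T3 and t = "reassoc H" and f = "\<lambda>t. Eps3 (com1 t)"])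
    fix x y z assume xyz: "x \<in> carrier H" "y \<in> carrier H" "z \<in> carrier H"
    show "Eps3 (com1 (p3 x y z)) = tsum K T3 (eps2 (p3 x y z))
      (\<lambda>x v. tsum K T3 (comul H x) (\<lambda>x1 x2. p3 x1 x2 v))"
      \<comment> \<open>The scalar \<epsilon>(y) is kept inside the last slot, so that both sides
        are the same bilinear map evaluated at x and \<epsilon>(y) z.\<close>
      by (subst slots_pure[OF xyz], rule trans[OF tsum_push[where P = T4 and P' = T3 and
            G = "\<lambda>x1 x2. p3 x1 x2 (counit H y \<odot> z)"]])
        (simp_all add: xyz slots_pure(2) del: tpure_smult)
  qed simp_all
  hence com1: "Eps3 (com1 (reassoc H)) = p3 \<one> \<one> \<one>" by (simp add: eps2_reassoc)
  note m = ring_hom_mult[OF slots_ring_hom(5)]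
  have "Eps3 (emb1 (reassoc H) \<otimes>\<^bsub>A4\<^esub> com2 (reassoc H) \<otimes>\<^bsub>A4\<^esub> emb4 (reassoc H))
      = Eps3 (com3 (reassoc H) \<otimes>\<^bsub>A4\<^esub> com1 (reassoc H))"
    by (simp add: pentagon_slots)
  hence "reassoc H \<otimes>\<^bsub>A3\<^esub> eps3 (reassoc H) = reassoc H"
    by (simp add: m com1 com2 com3 emb4) (simp add: emb1_def eps2_reassoc)
  hence "reassoc_inv K H \<otimes>\<^bsub>A3\<^esub> (reassoc H \<otimes>\<^bsub>A3\<^esub> eps3 (reassoc H)) = p3 \<one> \<one> \<one>" by simp
  thus ?thesis
    using monoid.m_assoc[OF ring.is_monoid[OF ring_A(2)], of "reassoc_inv K H" "reassoc H" "eps3 (reassoc H)"]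
    by simp
qed

text \<open>The same argument with \<epsilon> in the second slot: \<open>com1\<close> and
  \<open>com2\<close> give \<Phi>, \<open>emb4\<close> and \<open>com3\<close> give 1, and
  cancelling \<Phi> on the right leaves 1 \<otimes> \<open>eps1\<close> of \<Phi> equal to
  1.\<close>

lemma eps1_reassoc: "eps1 (reassoc H) = p2 \<one> \<one>"
proof -
  have com2: "Eps2 (com2 (reassoc H)) = reassoc H"
  proof (rule ext3[where P = T3])
    fix x y z assume xyz: "x \<in> carrier H" "y \<in> carrier H" "z \<in> carrier H"
    have "Eps2 (com2 (p3 x y z)) = tsum K T3 (comul H y) (\<lambda>y1 y2. counit H y1 \<odot>\<^bsub>T3\<^esub> p3 x y2 z)"
      by (subst slots_pure[OF xyz], rule tsum_push[where P = T4]) (simp_all add: xyz)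
    also have "\<dots> = p3 x y z" by (rule tsum_counit_left) (simp_all add: xyz)
    finally show "Eps2 (com2 (p3 x y z)) = p3 x y z" .
  qed simp_all
  have com1: "Eps2 (com1 (reassoc H)) = reassoc H"
  proof (rule ext3[where P = T3])
    fix x y z assume xyz: "x \<in> carrier H" "y \<in> carrier H" "z \<in> carrier H"
    have "Eps2 (com1 (p3 x y z)) = tsum K T3 (comul H x) (\<lambda>x1 x2. counit H x2 \<odot>\<^bsub>T3\<^esub> p3 x1 y z)"
      by (subst slots_pure[OF xyz], rule tsum_push[where P = T4]) (simp_all add: xyz)
    also have "\<dots> = p3 x y z" by (rule tsum_counit_right) (simp_all add: xyz)
    finally show "Eps2 (com1 (p3 x y z)) = p3 x y z" .
  qed simp_all
  have "Eps2 (emb4 (reassoc H)) = tsum K T3 (eps2 (reassoc H)) (\<lambda>x v. p3 x v \<one>)"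
    by (rule ext3[where P = T3]) (simp_all add: slots_pure(2) del: tpure_smult, simp)
  hence emb4: "Eps2 (emb4 (reassoc H)) = p3 \<one> \<one> \<one>" by (simp add: eps2_reassoc)
  have "Eps2 (com3 (reassoc H)) = tsum K T3 (eps2 (reassoc H)) (\<lambda>x v. tpure K H T2 x (comul H v))"
    by (rule ext3[where P = T3])
      (simp_all add: slots_pure(2) lin_hom_smult[OF comul_lin] del: tpure_smult)
  hence com3: "Eps2 (com3 (reassoc H)) = p3 \<one> \<one> \<one>" by (simp add: eps2_reassoc)
  note m = ring_hom_mult[OF slots_ring_hom(4)]
  have "Eps2 (emb1 (reassoc H) \<otimes>\<^bsub>A4\<^esub> com2 (reassoc H) \<otimes>\<^bsub>A4\<^esub> emb4 (reassoc H))
      = Eps2 (com3 (reassoc H) \<otimes>\<^bsub>A4\<^esub> com1 (reassoc H))"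
    by (simp add: pentagon_slots)
  hence "tpure K H T2 \<one> (eps1 (reassoc H)) \<otimes>\<^bsub>A3\<^esub> reassoc H = reassoc H"
    by (simp add: m com1 com2 com3 emb4) (simp add: emb1_def)
  hence "tpure K H T2 \<one> (eps1 (reassoc H)) \<otimes>\<^bsub>A3\<^esub> reassoc H \<otimes>\<^bsub>A3\<^esub> reassoc_inv K H = p3 \<one> \<one> \<one>"
    by simp
  hence "tpure K H T2 \<one> (eps1 (reassoc H)) = p3 \<one> \<one> \<one>"
    using monoid.m_assoc[OF ring.is_monoid[OF ring_A(2)], of "tpure K H T2 \<one> (eps1 (reassoc H))" "reassoc H" "reassoc_inv K H"]
    by simp
  \<comment> \<open>The leading 1 is stripped by one more \<epsilon>, since \<epsilon>(1) =
    1.\<close>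
  hence "eps1 (tpure K H T2 \<one> (eps1 (reassoc H))) = eps1 (p3 \<one> \<one> \<one>)" by simp
  thus ?thesis by simp
qed

text \<open>Each contraction is multiplicative, so its value at \<Phi>\<inverse> is inverse to its
  value 1 at \<Phi>.\<close>

lemma eps_reassoc_inv:
  "eps1 (reassoc_inv K H) = p2 \<one> \<one>" "eps2 (reassoc_inv K H) = p2 \<one> \<one>"
  "eps3 (reassoc_inv K H) = p3 \<one> \<one> \<one>"
proof -
  have r: "t \<otimes>\<^bsub>A2\<^esub> p2 \<one> \<one> = t" if "t \<in> carrier T2" for t
    using monoid.r_one[OF ring.is_monoid[OF ring_A(1)], of t] that by simp
  show "eps1 (reassoc_inv K H) = p2 \<one> \<one>"
    using ring_hom_mult[OF slots_ring_hom(1), of "reassoc_inv K H" "reassoc H"]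
    by (simp add: eps1_reassoc r)
  show "eps2 (reassoc_inv K H) = p2 \<one> \<one>"
    using ring_hom_mult[OF slots_ring_hom(2), of "reassoc_inv K H" "reassoc H"]
    by (simp add: eps2_reassoc r)
  show "eps3 (reassoc_inv K H) = p3 \<one> \<one> \<one>"
    using ring_hom_mult[OF slots_ring_hom(3), of "reassoc_inv K H" "reassoc H"]
    by (simp add: eps3_reassoc)
qed

end

section \<open>The coinvariants of the smash product\<close>

locale smash_setting = quasi_hopf_algebra K H + A: left_module_algebra K H A
  for K :: "('k, 'm) ring_scheme" and H :: "('k, 'h, 'p) quasi_hopf_scheme" (structure)
    and A :: "('k, 'h, 'a, 'q) module_algebra_scheme"
begin

abbreviation "TB \<equiv> tensor_module K A H"
abbreviation "TBH \<equiv> tensor_module K TB H"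
abbreviation "B \<equiv> smash K H A"
abbreviation "sm \<equiv> tpure K A H"
abbreviation "S \<equiv> antipode H"
abbreviation "Sinv \<equiv> inv_into (carrier H) S"
abbreviation "E \<equiv> smash_E K H A"
abbreviation "j \<equiv> smash_j K H A"

lemma module_A [simp]: "module K A" by (rule A.module_axioms)

declare alpha_closed [simp] beta_closed [simp] A.act_closed [simp] A.unit_closed [simp]
  A.unit_left [simp] A.unit_right [simp] A.mult_closed [simp] A.act_one [simp]
  A.act_smult_left [simp] A.act_smult_right [simp] A.act_on_one [simp]
  A.mult_smult_left [simp] A.mult_smult_right [simp] A.act_mult [simp]
  antipode_one [simp] antipode_mult [simp] smult_mult_left [simp] smult_mult_right [simp]

lemma antipode_closed [simp]: "h \<in> carrier H \<Longrightarrow> S h \<in> carrier H"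
  by (rule lin_hom_closed[OF antipode_linear])

lemma antipode_inv_closed [simp]: "h \<in> carrier H \<Longrightarrow> Sinv h \<in> carrier H"
  using antipode_bij by (metis bij_betw_def inv_into_into)

lemma antipode_antipode_inv [simp]: "h \<in> carrier H \<Longrightarrow> S (Sinv h) = h"
  using antipode_bij by (metis bij_betw_def f_inv_into_f)

text \<open>Needed because \<open>q_elem\<close> is a Sweedler sum whose summand contains
  \<open>Sinv\<close>. The equations are checked after applying the injective
  \<open>S\<close>.\<close>

lemma antipode_inv_linear [simp]: "Sinv \<in> lin_hom K H H"
proof -
  have inj: "inj_on S (carrier H)" using antipode_bij by (simp add: bij_betw_def)
  show ?thesis
    by (rule lin_homI, simp) (rule inj_onD[OF inj];
      simp add: lin_hom_add[OF antipode_linear] lin_hom_smult[OF antipode_linear])+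
qed

lemma bilin_act: "bilin K H A A (act A)"
  by (intro bilinI lin_homI) (simp_all add: A.act_add_left A.act_add_right)

lemma bilin_mult_A: "bilin K A A A (mult A)"
  by (intro bilinI lin_homI) (simp_all add: A.mult_add_left A.mult_add_right)

lemma j_linear [simp]: "j \<in> lin_hom K H TB"
  unfolding smash_j_def[abs_def] by simp

lemmas lin_smash [simp] =
  bilin_left[OF bilin_act] bilin_right[OF bilin_act]
  bilin_left[OF bilin_mult_A] bilin_right[OF bilin_mult_A]
  lin_hom_compose[OF antipode_linear] lin_hom_compose[OF antipode_inv_linear]
  lin_hom_compose[OF j_linear]
  lin_hom_compose[OF lin_hom_tsum[of K H T3]] lin_hom_tsum_param[of K H T3]
  lin_hom_compose[OF lin_hom_tsum[of K A H]] lin_hom_tsum_param[of K A H]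
  lin_hom_compose[OF lin_hom_tsum[of K TB H]] lin_hom_tsum_param[of K TB H]

lemma tsum_closed' [simp]:
  "\<lbrakk>module K P; bilin K H T2 P F; t \<in> carrier T3\<rbrakk> \<Longrightarrow> tsum K P t F \<in> carrier P"
  "\<lbrakk>module K P; bilin K A H P F'; t' \<in> carrier TB\<rbrakk> \<Longrightarrow> tsum K P t' F' \<in> carrier P"
  "\<lbrakk>module K P; bilin K TB H P F''; t'' \<in> carrier TBH\<rbrakk> \<Longrightarrow> tsum K P t'' F'' \<in> carrier P"
  by (rule tsum_carrier[of K H T2]; simp) (rule tsum_carrier[of K A H] tsum_carrier[of K TB H]; simp)+

lemma tsum_smult [simp]:
  "\<lbrakk>module K P; bilin K H H P F; c \<in> carrier K; t \<in> carrier T2\<rbrakk> \<Longrightarrow>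
    tsum K P (c \<odot>\<^bsub>T2\<^esub> t) F = c \<odot>\<^bsub>P\<^esub> tsum K P t F"
  "\<lbrakk>module K P; bilin K H T2 P G; c \<in> carrier K; u \<in> carrier T3\<rbrakk> \<Longrightarrow>
    tsum K P (c \<odot>\<^bsub>T3\<^esub> u) G = c \<odot>\<^bsub>P\<^esub> tsum K P u G"
  by (simp_all add: lin_hom_smult[OF lin_hom_tsum[of K H H]] lin_hom_smult[OF lin_hom_tsum[of K H T2]])

text \<open>The axiom for \<beta> inside a larger expression: L is the linear context around h_1
  \<beta> S(h_2), and F may be any summand that agrees with it.\<close>

lemma antipode_beta_push:
  assumes "module K P" "L \<in> lin_hom K H P" "h \<in> carrier H" "bilin K H H P F"
    and "\<And>x y. x \<in> carrier H \<Longrightarrow> y \<in> carrier H \<Longrightarrow> F x y = L (x \<otimes> beta H \<otimes> S y)"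
  shows "tsum K P (comul H h) F = counit H h \<odot>\<^bsub>P\<^esub> L (beta H)"
proof -
  have "L (tsum K H (comul H h) (\<lambda>x y. x \<otimes> beta H \<otimes> S y)) = tsum K P (comul H h) F"
    by (rule tsum_push) (simp_all add: assms)
  thus ?thesis using assms by (simp add: antipode_beta lin_hom_smult[OF assms(2)])
qed

lemma antipode_alpha_push:
  assumes "module K P" "L \<in> lin_hom K H P" "h \<in> carrier H" "bilin K H H P F"
    and "\<And>x y. x \<in> carrier H \<Longrightarrow> y \<in> carrier H \<Longrightarrow> F x y = L (S x \<otimes> alpha H \<otimes> y)"
  shows "tsum K P (comul H h) F = counit H h \<odot>\<^bsub>P\<^esub> L (alpha H)"
proof -
  have "L (tsum K H (comul H h) (\<lambda>x y. S x \<otimes> alpha H \<otimes> y)) = tsum K P (comul H h) F"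
    by (rule tsum_push) (simp_all add: assms)
  thus ?thesis using assms by (simp add: antipode_alpha lin_hom_smult[OF assms(2)])
qed

lemma ext2:
  assumes "f \<in> lin_hom K T2 P" "g \<in> lin_hom K T2 P" "module K P" "t \<in> carrier T2"
    and "\<And>x y. \<lbrakk>x \<in> carrier H; y \<in> carrier H\<rbrakk> \<Longrightarrow> f (p2 x y) = g (p2 x y)"
  shows "f t = g t"
  by (rule lin_hom_tensor_eqI[of K H H, OF _ _ assms(1,2,3) _ assms(4)]) (simp_all add: assms)

lemma ext4:
  assumes "f \<in> lin_hom K T4 P" "g \<in> lin_hom K T4 P" "module K P" "t \<in> carrier T4"
    and eq: "\<And>w x y z. \<lbrakk>w \<in> carrier H; x \<in> carrier H; y \<in> carrier H; z \<in> carrier H\<rbrakk> \<Longrightarrow>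
      f (p4 w x y z) = g (p4 w x y z)"
  shows "f t = g t"
proof (rule lin_hom_tensor_eqI[of K H T3, OF _ _ assms(1,2,3) _ assms(4)])
  fix x u assume x: "x \<in> carrier H" and u: "u \<in> carrier T3"
  show "f (tpure K H T3 x u) = g (tpure K H T3 x u)"
    by (rule ext3[OF _ _ assms(3) u])
      (simp_all add: x eq lin_hom_compose[OF assms(1)] lin_hom_compose[OF assms(2)])
qed simp_all

subsection \<open>The contraction\<close>

definition "contr a t = tsum K TB t (\<lambda>w u. tsum K TB u (\<lambda>x v. tsum K TB v (\<lambda>y z.
  sm (w \<cdot>\<^bsub>A\<^esub> a) (x \<otimes> beta H \<otimes> S y \<otimes> alpha H \<otimes> z))))"

context
  fixes a assumes a [simp]: "a \<in> carrier A"
begin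

lemma contr_lin [simp]: "contr a \<in> lin_hom K T4 TB"
  unfolding contr_def[abs_def] by simp

lemmas contr_compose [simp] = lin_hom_compose[OF contr_lin]

lemma contr_pure [simp]:
  "\<lbrakk>w \<in> carrier H; x \<in> carrier H; y \<in> carrier H; z \<in> carrier H\<rbrakk> \<Longrightarrow>
    contr a (p4 w x y z) = sm (w \<cdot>\<^bsub>A\<^esub> a) (x \<otimes> beta H \<otimes> S y \<otimes> alpha H \<otimes> z)"
  unfolding contr_def by simp

text \<open>The doubled slot falls on both sides of \<beta>: x q_1 \<beta> S(y q_2) = x (q_1 \<beta>
  S(q_2)) S(y) = \<epsilon>(q) x \<beta> S(y). So \<Phi> enters only through \<open>eps2\<close>,
  where it is 1.\<close>

lemma contr_com2_reassoc:
  assumes t: "t \<in> carrier T4"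
  shows "contr a (t \<otimes>\<^bsub>A4\<^esub> com2 (reassoc H)) = contr a t"
proof (rule ext4[OF _ _ _ t, where P = TB])
  fix w x y z assume c [simp]: "w \<in> carrier H" "x \<in> carrier H" "y \<in> carrier H" "z \<in> carrier H"
  let ?F = "\<lambda>p r. sm ((w \<otimes> p) \<cdot>\<^bsub>A\<^esub> a) (x \<otimes> beta H \<otimes> S y \<otimes> alpha H \<otimes> z \<otimes> r)"
  have "contr a (p4 w x y z \<otimes>\<^bsub>A4\<^esub> com2 (reassoc H)) = tsum K TB (eps2 (reassoc H)) ?F"
  proof (rule ext3[where P = TB and t = "reassoc H" and f = "\<lambda>t. contr a (p4 w x y z \<otimes>\<^bsub>A4\<^esub> com2 t)"])
    fix p q r assume c' [simp]: "p \<in> carrier H" "q \<in> carrier H" "r \<in> carrier H"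
    let ?G = "\<lambda>q1 q2. sm ((w \<otimes> p) \<cdot>\<^bsub>A\<^esub> a) (x \<otimes> q1 \<otimes> beta H \<otimes> S (y \<otimes> q2) \<otimes> alpha H \<otimes> (z \<otimes> r))"
    have "contr a (p4 w x y z \<otimes>\<^bsub>A4\<^esub> com2 (p3 p q r)) = tsum K TB (comul H q) ?G"
      by (subst slots_pure, simp_all, rule tsum_push[where P = T4]) simp_all
    also have "\<dots> = counit H q \<odot>\<^bsub>TB\<^esub> sm ((w \<otimes> p) \<cdot>\<^bsub>A\<^esub> a) (x \<otimes> beta H \<otimes> S y \<otimes> alpha H \<otimes> (z \<otimes> r))"
      by (rule antipode_beta_push[where
            L = "\<lambda>k. sm ((w \<otimes> p) \<cdot>\<^bsub>A\<^esub> a) (x \<otimes> k \<otimes> S y \<otimes> alpha H \<otimes> (z \<otimes> r))"])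
        (simp_all add: m_assoc)
    also have "\<dots> = tsum K TB (eps2 (p3 p q r)) ?F" by (simp add: m_assoc)
    finally show "contr a (p4 w x y z \<otimes>\<^bsub>A4\<^esub> com2 (p3 p q r)) = tsum K TB (eps2 (p3 p q r)) ?F" .
  qed simp_all
  thus "contr a (p4 w x y z \<otimes>\<^bsub>A4\<^esub> com2 (reassoc H)) = contr a (p4 w x y z)"
    by (simp add: eps2_reassoc)
qed simp_all

text \<open>Here the doubled slot surrounds \<alpha>: S(z_1 q) \<alpha> z_2 r = S(q) (S(z_1)
  \<alpha> z_2) r = \<epsilon>(z) S(q) \<alpha> r, and summing p \<beta> S(q) \<alpha> r over \<Phi>
  gives 1. The result is phrased through \<open>eps3 t\<close> to prepare t = \<Phi>\<inverse>; the
  further \<epsilon> is harmless, since \<epsilon>(\<epsilon>(z) 1) = \<epsilon>(z).\<close>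

lemma contr_com3_emb1_reassoc:
  assumes t: "t \<in> carrier T3"
  shows "contr a (com3 t \<otimes>\<^bsub>A4\<^esub> emb1 (reassoc H))
    = tsum3 K TB (eps3 t) (\<lambda>x y z. counit H z \<odot>\<^bsub>TB\<^esub> sm (x \<cdot>\<^bsub>A\<^esub> a) y)"
proof (rule ext3[OF _ _ _ t, where P = TB])
  fix x y z assume c [simp]: "x \<in> carrier H" "y \<in> carrier H" "z \<in> carrier H"
  let ?L = "\<lambda>k. counit H z \<odot>\<^bsub>TB\<^esub> sm (x \<cdot>\<^bsub>A\<^esub> a) (y \<otimes> k)"
  have "contr a (com3 (p3 x y z) \<otimes>\<^bsub>A4\<^esub> emb1 (reassoc H))
    = ?L (tsum3 K H (reassoc H) (\<lambda>p q r. p \<otimes> beta H \<otimes> S q \<otimes> alpha H \<otimes> r))"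
  proof (rule ext3[where P = TB and t = "reassoc H" and f = "\<lambda>t. contr a (com3 (p3 x y z) \<otimes>\<^bsub>A4\<^esub> emb1 t)"])
    fix p q r assume c' [simp]: "p \<in> carrier H" "q \<in> carrier H" "r \<in> carrier H"
    have "contr a (com3 (p3 x y z) \<otimes>\<^bsub>A4\<^esub> emb1 (p3 p q r))
      = tsum K TB (comul H z) (\<lambda>z1 z2. sm (x \<cdot>\<^bsub>A\<^esub> a)
          ((y \<otimes> p) \<otimes> beta H \<otimes> S (z1 \<otimes> q) \<otimes> alpha H \<otimes> (z2 \<otimes> r)))"
      \<comment> \<open>\<open>com3\<close> leaves \<Delta>(z) unsplit in the last two slots; both
        sides are linear in it, so it may be taken to be pure.\<close>
      by (simp add: emb1_def, rule ext2[where P = TB]) simp_all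
    also have "\<dots> = counit H z \<odot>\<^bsub>TB\<^esub> sm (x \<cdot>\<^bsub>A\<^esub> a) (y \<otimes> p \<otimes> beta H \<otimes> S q \<otimes> alpha H \<otimes> r)"
      by (rule antipode_alpha_push[where
            L = "\<lambda>k. sm (x \<cdot>\<^bsub>A\<^esub> a) (y \<otimes> p \<otimes> beta H \<otimes> S q \<otimes> k \<otimes> r)"])
        (simp_all add: m_assoc)
    also have "\<dots> = ?L (tsum3 K H (p3 p q r) (\<lambda>p q r. p \<otimes> beta H \<otimes> S q \<otimes> alpha H \<otimes> r))"
      by (simp add: m_assoc)
    finally show "contr a (com3 (p3 x y z) \<otimes>\<^bsub>A4\<^esub> emb1 (p3 p q r))
      = ?L (tsum3 K H (p3 p q r) (\<lambda>p q r. p \<otimes> beta H \<otimes> S q \<otimes> alpha H \<otimes> r))" .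
  qed simp_all
  thus "contr a (com3 (p3 x y z) \<otimes>\<^bsub>A4\<^esub> emb1 (reassoc H))
    = tsum3 K TB (eps3 (p3 x y z)) (\<lambda>x y z. counit H z \<odot>\<^bsub>TB\<^esub> sm (x \<cdot>\<^bsub>A\<^esub> a) y)"
    \<comment> \<open>The first pass keeps \<open>tsum3\<close> folded so that the antipode axiom
      matches; the second evaluates the sum on the pure tensor.\<close>
    by (simp add: reassoc_antipode counit_smult del: tsum3_def) simp
qed simp_all

text \<open>The pentagon is multiplied by the inverse of its \<open>com3\<close> factor on the left
  and of its \<open>emb4\<close> factor on the right. This leaves \<open>com2\<close> rightmost,
  where the contraction absorbs it, and then the product of the other two collapses.\<close>

lemma contr_com1_emb4:
  "contr a (com1 (reassoc H) \<otimes>\<^bsub>A4\<^esub> emb4 (reassoc_inv K H)) = sm a \<one>"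
proof -
  interpret A4: ring A4 by (rule ring_A)
  have 1: "com3 (reassoc_inv K H) \<otimes>\<^bsub>A4\<^esub> com3 (reassoc H) = \<one>\<^bsub>A4\<^esub>"
    using ring_hom_mult[OF slots_ring_hom(7), of "reassoc_inv K H" "reassoc H"] by simp
  have 2: "emb4 (reassoc H) \<otimes>\<^bsub>A4\<^esub> emb4 (reassoc_inv K H) = \<one>\<^bsub>A4\<^esub>"
    using ring_hom_mult[OF slots_ring_hom(6), of "reassoc H" "reassoc_inv K H"] by simp
  have "com1 (reassoc H) \<otimes>\<^bsub>A4\<^esub> emb4 (reassoc_inv K H)
      = com3 (reassoc_inv K H) \<otimes>\<^bsub>A4\<^esub> com3 (reassoc H) \<otimes>\<^bsub>A4\<^esub> (com1 (reassoc H) \<otimes>\<^bsub>A4\<^esub> emb4 (reassoc_inv K H))"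
    unfolding 1 using A4.l_one by simp
  also have "\<dots> = com3 (reassoc_inv K H) \<otimes>\<^bsub>A4\<^esub> (com3 (reassoc H) \<otimes>\<^bsub>A4\<^esub> com1 (reassoc H)) \<otimes>\<^bsub>A4\<^esub> emb4 (reassoc_inv K H)"
    using A4.m_assoc by simp
  also have "\<dots> = com3 (reassoc_inv K H) \<otimes>\<^bsub>A4\<^esub> emb1 (reassoc H) \<otimes>\<^bsub>A4\<^esub> com2 (reassoc H)
      \<otimes>\<^bsub>A4\<^esub> (emb4 (reassoc H) \<otimes>\<^bsub>A4\<^esub> emb4 (reassoc_inv K H))"
    unfolding pentagon_slots[symmetric] using A4.m_assoc by simp
  also have "\<dots> = com3 (reassoc_inv K H) \<otimes>\<^bsub>A4\<^esub> emb1 (reassoc H) \<otimes>\<^bsub>A4\<^esub> com2 (reassoc H)"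
    unfolding 2 using A4.r_one by simp
  finally show ?thesis
    by (simp add: contr_com2_reassoc contr_com3_emb1_reassoc eps_reassoc_inv del: tsum3_def) simp
qed

end

end

context smash_setting
begin

subsection \<open>The smash product\<close>

lemma smash_mult_eq:
  "mult B = (\<lambda>b b'. tsum K TB b (\<lambda>a h. tsum K TB b' (\<lambda>a' h'.
    tsum3 K TB (reassoc_inv K H) (\<lambda>x1 x2 x3. tsum K TB (comul H h) (\<lambda>h1 h2.
      sm ((x1 \<cdot>\<^bsub>A\<^esub> a) \<otimes>\<^bsub>A\<^esub> ((x2 \<otimes> h1) \<cdot>\<^bsub>A\<^esub> a')) (x3 \<otimes> h2 \<otimes> h'))))))"
  by (simp add: smash_def)

lemma smash_mult_bilin: "bilin K TB TB TB (mult B)"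
  unfolding smash_mult_eq by simp

lemmas smash_mult_lin [simp] = bilin_left[OF smash_mult_bilin] bilin_right[OF smash_mult_bilin]

lemma smash_mult_closed [simp]: "b \<in> carrier TB \<Longrightarrow> b' \<in> carrier TB \<Longrightarrow> b \<otimes>\<^bsub>B\<^esub> b' \<in> carrier TB"
  by (rule bilin_closed[OF smash_mult_bilin])

lemma smash_mult_pure:
  assumes "a \<in> carrier A" "h \<in> carrier H" "a' \<in> carrier A" "h' \<in> carrier H"
  shows "sm a h \<otimes>\<^bsub>B\<^esub> sm a' h' = tsum3 K TB (reassoc_inv K H) (\<lambda>x1 x2 x3. tsum K TB (comul H h) (\<lambda>h1 h2.
      sm ((x1 \<cdot>\<^bsub>A\<^esub> a) \<otimes>\<^bsub>A\<^esub> ((x2 \<otimes> h1) \<cdot>\<^bsub>A\<^esub> a')) (x3 \<otimes> h2 \<otimes> h')))"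
  unfolding smash_mult_eq using assms by simp

lemma j_closed [simp]: "g \<in> carrier H \<Longrightarrow> j g \<in> carrier TB"
  by (simp add: smash_j_def)

text \<open>The first slot of \<Phi>\<inverse> acts on the unit of A, hence by \<epsilon>, so
  \<Phi>\<inverse> contributes only through \<open>eps1\<close>.\<close>

lemma j_mult:
  assumes [simp]: "g \<in> carrier H" "a \<in> carrier A" "h \<in> carrier H"
  shows "j g \<otimes>\<^bsub>B\<^esub> sm a h = tsum K TB (comul H g) (\<lambda>g1 g2. sm (g1 \<cdot>\<^bsub>A\<^esub> a) (g2 \<otimes> h))"
proof -
  let ?F = "\<lambda>x2 x3. tsum K TB (comul H g) (\<lambda>g1 g2. sm ((x2 \<otimes> g1) \<cdot>\<^bsub>A\<^esub> a) (x3 \<otimes> g2 \<otimes> h))"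
  have "j g \<otimes>\<^bsub>B\<^esub> sm a h = tsum3 K TB (reassoc_inv K H) (\<lambda>x1 x2 x3. tsum K TB (comul H g) (\<lambda>g1 g2.
      sm ((x1 \<cdot>\<^bsub>A\<^esub> \<one>\<^bsub>A\<^esub>) \<otimes>\<^bsub>A\<^esub> ((x2 \<otimes> g1) \<cdot>\<^bsub>A\<^esub> a)) (x3 \<otimes> g2 \<otimes> h)))"
    unfolding smash_j_def by (rule smash_mult_pure) simp_all
  also have "\<dots> = tsum K TB (eps1 (reassoc_inv K H)) ?F"
  proof (rule ext3[where P = TB and t = "reassoc_inv K H" and g = "\<lambda>t. tsum K TB (eps1 t) ?F"])
    fix x y z assume c [simp]: "x \<in> carrier H" "y \<in> carrier H" "z \<in> carrier H"
    have "tsum K TB (comul H g) (\<lambda>g1 g2.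
        sm ((x \<cdot>\<^bsub>A\<^esub> \<one>\<^bsub>A\<^esub>) \<otimes>\<^bsub>A\<^esub> ((y \<otimes> g1) \<cdot>\<^bsub>A\<^esub> a)) (z \<otimes> g2 \<otimes> h)) = counit H x \<odot>\<^bsub>TB\<^esub> ?F y z"
      by (rule tsum_push[where f = "\<lambda>b. counit H x \<odot>\<^bsub>TB\<^esub> b" and P = TB, symmetric]) simp_all
    thus "tsum3 K TB (p3 x y z) (\<lambda>x1 x2 x3. tsum K TB (comul H g) (\<lambda>g1 g2.
      sm ((x1 \<cdot>\<^bsub>A\<^esub> \<one>\<^bsub>A\<^esub>) \<otimes>\<^bsub>A\<^esub> ((x2 \<otimes> g1) \<cdot>\<^bsub>A\<^esub> a)) (x3 \<otimes> g2 \<otimes> h))) = tsum K TB (eps1 (p3 x y z)) ?F"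
      by simp
  qed simp_all
  also have "\<dots> = ?F \<one> \<one>" by (simp add: eps_reassoc_inv)
  also have "\<dots> = tsum K TB (comul H g) (\<lambda>g1 g2. sm (g1 \<cdot>\<^bsub>A\<^esub> a) (g2 \<otimes> h))"
    by (rule tsum_cong[of K H H]) simp_all
  finally show ?thesis .
qed

text \<open>Now x^2 h_1 acts on the unit of A: \<epsilon>(x^2) trivialises \<Phi>\<inverse> through
  \<open>eps2\<close>, and \<epsilon>(h_1) reduces \<Delta>(h) to h.\<close>

lemma mult_j:
  assumes [simp]: "g \<in> carrier H" "a \<in> carrier A" "h \<in> carrier H"
  shows "sm a h \<otimes>\<^bsub>B\<^esub> j g = sm a (h \<otimes> g)"
proof -
  let ?F = "\<lambda>x z. sm (x \<cdot>\<^bsub>A\<^esub> a) (z \<otimes> h \<otimes> g)"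
  have "sm a h \<otimes>\<^bsub>B\<^esub> j g = tsum3 K TB (reassoc_inv K H) (\<lambda>x1 x2 x3. tsum K TB (comul H h) (\<lambda>h1 h2.
      sm ((x1 \<cdot>\<^bsub>A\<^esub> a) \<otimes>\<^bsub>A\<^esub> ((x2 \<otimes> h1) \<cdot>\<^bsub>A\<^esub> \<one>\<^bsub>A\<^esub>)) (x3 \<otimes> h2 \<otimes> g)))"
    unfolding smash_j_def by (rule smash_mult_pure) simp_all
  also have "\<dots> = tsum K TB (eps2 (reassoc_inv K H)) ?F"
  proof (rule ext3[where P = TB and t = "reassoc_inv K H" and g = "\<lambda>t. tsum K TB (eps2 t) ?F"])
    fix x y z assume c [simp]: "x \<in> carrier H" "y \<in> carrier H" "z \<in> carrier H"
    have "tsum K TB (comul H h) (\<lambda>h1 h2.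
        sm ((x \<cdot>\<^bsub>A\<^esub> a) \<otimes>\<^bsub>A\<^esub> ((y \<otimes> h1) \<cdot>\<^bsub>A\<^esub> \<one>\<^bsub>A\<^esub>)) (z \<otimes> h2 \<otimes> g))
      = tsum K TB (comul H h) (\<lambda>h1 h2. counit H h1 \<odot>\<^bsub>TB\<^esub> (counit H y \<odot>\<^bsub>TB\<^esub> sm (x \<cdot>\<^bsub>A\<^esub> a) (z \<otimes> h2 \<otimes> g)))"
      by (rule tsum_cong[of K H H])
        (simp_all add: module.smult_assoc1[OF module_A, symmetric]
          module.smult_assoc1[OF module_tensor_module[OF module_A module_H], symmetric] K.m_comm)
    also have "\<dots> = counit H y \<odot>\<^bsub>TB\<^esub> ?F x z"
      by (rule tsum_counit_left) simp_all
    finally show "tsum3 K TB (p3 x y z) (\<lambda>x1 x2 x3. tsum K TB (comul H h) (\<lambda>h1 h2.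
      sm ((x1 \<cdot>\<^bsub>A\<^esub> a) \<otimes>\<^bsub>A\<^esub> ((x2 \<otimes> h1) \<cdot>\<^bsub>A\<^esub> \<one>\<^bsub>A\<^esub>)) (x3 \<otimes> h2 \<otimes> g))) = tsum K TB (eps2 (p3 x y z)) ?F"
      by simp
  qed simp_all
  also have "\<dots> = sm a (h \<otimes> g)" by (simp add: eps_reassoc_inv)
  finally show ?thesis .
qed

lemma j_mult_j:
  assumes [simp]: "g \<in> carrier H" "a \<in> carrier A" "h \<in> carrier H" "k \<in> carrier H"
  shows "j g \<otimes>\<^bsub>B\<^esub> sm a h \<otimes>\<^bsub>B\<^esub> j k
    = tsum K TB (comul H g) (\<lambda>g1 g2. sm (g1 \<cdot>\<^bsub>A\<^esub> a) (g2 \<otimes> h \<otimes> k))"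
  unfolding j_mult[OF assms(1-3)]
  by (rule tsum_push[where P = TB]) (simp_all add: mult_j)

subsection \<open>The projection\<close>

text \<open>The coaction with a variable s in place of \<Phi>\<inverse>, so that statements about it
  can be checked on pure s.\<close>

definition "coact_on s b = tsum K TBH b (\<lambda>a h. tsum3 K TBH s (\<lambda>x1 x2 x3.
  tsum K TBH (comul H h) (\<lambda>h1 h2. tpure K TB H (sm (x1 \<cdot>\<^bsub>A\<^esub> a) (x2 \<otimes> h1)) (x3 \<otimes> h2))))"

lemma smash_coaction_eq: "smash_coaction K H A = coact_on (reassoc_inv K H)"
  by (intro ext) (simp add: smash_coaction_def coact_on_def)

lemma coact_on_lin: "s \<in> carrier T3 \<Longrightarrow> coact_on s \<in> lin_hom K TB TBH"
  unfolding coact_on_def[abs_def] by simp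

lemmas coact_on_compose [simp] = lin_hom_compose[OF coact_on_lin]
lemmas coact_on_closed [simp] = lin_hom_closed[OF coact_on_lin]

lemma coact_on_pure:
  "\<lbrakk>a \<in> carrier A; h \<in> carrier H; s \<in> carrier T3\<rbrakk> \<Longrightarrow> coact_on s (sm a h) = tsum3 K TBH s (\<lambda>x1 x2 x3.
    tsum K TBH (comul H h) (\<lambda>h1 h2. tpure K TB H (sm (x1 \<cdot>\<^bsub>A\<^esub> a) (x2 \<otimes> h1)) (x3 \<otimes> h2)))"
  unfolding coact_on_def by simp

lemma q_elem_closed [simp]: "q_elem K H \<in> carrier T2"
  by (simp add: q_elem_def)

lemma smash_E_eq:
  "E b = tsum K TB (q_elem K H) (\<lambda>q1 q2. tsum K TB (coact_on (reassoc_inv K H) b) (\<lambda>b0 b1.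
    j q1 \<otimes>\<^bsub>B\<^esub> b0 \<otimes>\<^bsub>B\<^esub> j (beta H \<otimes> S (q2 \<otimes> b1))))"
  by (simp add: smash_E_def smash_coaction_eq Let_def)

lemma smash_E_linear: "E \<in> lin_hom K TB TB"
  unfolding smash_E_eq[abs_def] by simp

text \<open>What is left of a summand of E after h has been absorbed, with g for q^1, k for S(q^2)
  and s for \<Phi>\<inverse>.\<close>

definition "inner a g k s = tsum3 K TB s (\<lambda>x1 x2 x3. tsum K TB (comul H g) (\<lambda>g1 g2.
  sm (g1 \<cdot>\<^bsub>A\<^esub> (x1 \<cdot>\<^bsub>A\<^esub> a)) (g2 \<otimes> x2 \<otimes> beta H \<otimes> S x3 \<otimes> k)))"

text \<open>As S reverses products, S(k z h_2) = S(h_2) S(z) S(k), so the two halves of \<Delta>(h)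
  meet around \<beta> and leave \<epsilon>(h).\<close>

lemma coact_inner:
  assumes s: "s \<in> carrier T3"
    and [simp]: "a \<in> carrier A" "h \<in> carrier H" "g \<in> carrier H" "k \<in> carrier H"
  shows "tsum K TB (coact_on s (sm a h)) (\<lambda>b0 b1. j g \<otimes>\<^bsub>B\<^esub> b0 \<otimes>\<^bsub>B\<^esub> j (beta H \<otimes> S (k \<otimes> b1)))
    = counit H h \<odot>\<^bsub>TB\<^esub> inner a g (S k) s"
  unfolding coact_on_pure[OF assms(2,3) s] inner_def
proof (rule ext3[OF _ _ _ s, where P = TB])
  fix x y z assume c [simp]: "x \<in> carrier H" "y \<in> carrier H" "z \<in> carrier H"
  let ?L = "\<lambda>m. tsum K TB (comul H g) (\<lambda>g1 g2.
    sm (g1 \<cdot>\<^bsub>A\<^esub> (x \<cdot>\<^bsub>A\<^esub> a)) (g2 \<otimes> y \<otimes> m \<otimes> S z \<otimes> S k))"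
  let ?G = "\<lambda>b0 b1. j g \<otimes>\<^bsub>B\<^esub> b0 \<otimes>\<^bsub>B\<^esub> j (beta H \<otimes> S (k \<otimes> b1))"
  have "tsum K TB (tsum K TBH (comul H h) (\<lambda>h1 h2. tpure K TB H (sm (x \<cdot>\<^bsub>A\<^esub> a) (y \<otimes> h1)) (z \<otimes> h2))) ?G
    = tsum K TB (comul H h) (\<lambda>h1 h2. ?G (sm (x \<cdot>\<^bsub>A\<^esub> a) (y \<otimes> h1)) (z \<otimes> h2))"
    by (rule tsum_push[where P = TBH]) simp_all
  also have "\<dots> = counit H h \<odot>\<^bsub>TB\<^esub> ?L (beta H)"
  proof (rule antipode_beta_push[where L = ?L])
    fix u v assume [simp]: "u \<in> carrier H" "v \<in> carrier H"
    show "?G (sm (x \<cdot>\<^bsub>A\<^esub> a) (y \<otimes> u)) (z \<otimes> v) = ?L (u \<otimes> beta H \<otimes> S v)"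
      unfolding j_mult_j[OF assms(4) A.act_closed[OF c(1) assms(2)] m_closed[OF c(2) \<open>u \<in> carrier H\<close>]
          m_closed[OF beta_closed antipode_closed[OF m_closed[OF assms(5) m_closed[OF c(3) \<open>v \<in> carrier H\<close>]]]]]
      by (rule tsum_cong[of K H H]) (simp_all add: m_assoc)
  qed simp_all
  finally show "tsum K TB (tsum3 K TBH (p3 x y z) (\<lambda>x1 x2 x3.
      tsum K TBH (comul H h) (\<lambda>h1 h2. tpure K TB H (sm (x1 \<cdot>\<^bsub>A\<^esub> a) (x2 \<otimes> h1)) (x3 \<otimes> h2)))) ?G
    = counit H h \<odot>\<^bsub>TB\<^esub> tsum3 K TB (p3 x y z) (\<lambda>x1 x2 x3. tsum K TB (comul H g) (\<lambda>g1 g2.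
  sm (g1 \<cdot>\<^bsub>A\<^esub> (x1 \<cdot>\<^bsub>A\<^esub> a)) (g2 \<otimes> x2 \<otimes> beta H \<otimes> S x3 \<otimes> S k)))"
    by simp
qed simp_all

text \<open>The value S(y) \<alpha> z for k is S(q^2) for a pure x \<otimes> y \<otimes> z in place
  of \<Phi>, which identifies the sum defining E with the contraction.\<close>

lemma contr_inner:
  assumes s: "s \<in> carrier T3"
    and [simp]: "a \<in> carrier A" "x \<in> carrier H" "y \<in> carrier H" "z \<in> carrier H"
  shows "contr a (com1 (p3 x y z) \<otimes>\<^bsub>A4\<^esub> emb4 s) = inner a x (S y \<otimes> alpha H \<otimes> z) s"
  unfolding inner_def
proof (rule ext3[OF _ _ _ s, where P = TB])
  fix p q r assume c [simp]: "p \<in> carrier H" "q \<in> carrier H" "r \<in> carrier H"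
  have "contr a (tsum K T4 (comul H x) (\<lambda>x1 x2. p4 x1 x2 y z) \<otimes>\<^bsub>A4\<^esub> p4 p q r \<one>)
    = tsum K TB (comul H x) (\<lambda>g1 g2.
      sm (g1 \<cdot>\<^bsub>A\<^esub> (p \<cdot>\<^bsub>A\<^esub> a)) (g2 \<otimes> q \<otimes> beta H \<otimes> S r \<otimes> (S y \<otimes> alpha H \<otimes> z)))"
    by (rule tsum_push[where P = T4]) (simp_all add: m_assoc)
  thus "contr a (com1 (p3 x y z) \<otimes>\<^bsub>A4\<^esub> emb4 (p3 p q r)) = tsum3 K TB (p3 p q r)
    (\<lambda>x1 x2 x3. tsum K TB (comul H x) (\<lambda>g1 g2.
      sm (g1 \<cdot>\<^bsub>A\<^esub> (x1 \<cdot>\<^bsub>A\<^esub> a)) (g2 \<otimes> x2 \<otimes> beta H \<otimes> S x3 \<otimes> (S y \<otimes> alpha H \<otimes> z))))"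
    by simp
qed simp_all

lemma inner_bilin [simp]:
  assumes "a \<in> carrier A" "s \<in> carrier T3"
  shows "bilin K H H TB (\<lambda>g k. inner a g (S k) s)"
  unfolding inner_def using assms by simp

lemma smash_E_pure:
  assumes [simp]: "a \<in> carrier A" "h \<in> carrier H"
  shows "E (sm a h) = counit H h \<odot>\<^bsub>TB\<^esub> sm a \<one>"
proof -
  let ?I = "\<lambda>g k. inner a g (S k) (reassoc_inv K H)"
  have "E (sm a h) = tsum K TB (q_elem K H) (\<lambda>q1 q2. counit H h \<odot>\<^bsub>TB\<^esub> ?I q1 q2)"
    unfolding smash_E_eq
    \<comment> \<open>S of the product of q^2 and b_1 has to stay unexpanded to match
      \<open>coact_inner\<close>.\<close>
    by (rule tsum_cong[of K H H]) (simp_all add: coact_inner bilinI bilin_left[OF inner_bilin] bilin_right[OF inner_bilin] del: antipode_mult)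
  also have "\<dots> = counit H h \<odot>\<^bsub>TB\<^esub> tsum K TB (q_elem K H) ?I"
    by (rule tsum_push[symmetric]) (simp_all add: bilinI bilin_left[OF inner_bilin] bilin_right[OF inner_bilin])
  \<comment> \<open>Only the \<Phi> inside \<open>q_elem\<close> is varied here; the
    \<Phi>\<inverse> from the coaction stays fixed, as both are needed together for the
    pentagon.\<close>
  also have "tsum K TB (q_elem K H) ?I = contr a (com1 (reassoc H) \<otimes>\<^bsub>A4\<^esub> emb4 (reassoc_inv K H))"
    unfolding q_elem_def
  proof (rule ext3[where P = TB and t = "reassoc H" and g = "\<lambda>t. contr a (com1 t \<otimes>\<^bsub>A4\<^esub> emb4 (reassoc_inv K H))"])
    fix x y z assume c [simp]: "x \<in> carrier H" "y \<in> carrier H" "z \<in> carrier H"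
    show "tsum K TB (tsum3 K A2 (p3 x y z) (\<lambda>X1 X2 X3. p2 X1 (Sinv (alpha H \<otimes> X3) \<otimes> X2))) ?I
      = contr a (com1 (p3 x y z) \<otimes>\<^bsub>A4\<^esub> emb4 (reassoc_inv K H))"
      unfolding contr_inner[OF reassoc_inv_closed assms(1) c]
      by (simp add: m_assoc)
  qed (simp_all add: lin_hom_compose[OF lin_hom_tsum[of K H H]])
  also have "\<dots> = sm a \<one>" by (rule contr_com1_emb4) simp
  finally show ?thesis .
qed

end

section \<open>Transport of module algebra structures along linear surjections\<close>

lemma module_transport:
  assumes M: "module K M" and f: "f \<in> lin_hom K M N"
    and carrier: "carrier N = f ` carrier M" and zero: "\<zero>\<^bsub>N\<^esub> = f \<zero>\<^bsub>M\<^esub>"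
  shows "module K N"
proof -
  interpret M: module K M by fact
  \<comment> \<open>Read backwards, linearity writes sums and multiples in \<open>N\<close> as
    images under f, where the laws of \<open>M\<close> apply. The zero of \<open>N\<close> is a
    separate hypothesis because \<open>lin_hom_zero\<close> presupposes that \<open>N\<close> is a
    module.\<close>
  note lin = lin_hom_add[OF f, symmetric] lin_hom_smult[OF f, symmetric]
  show ?thesis
  proof (rule moduleI)
    show "cring K" by (rule M.R.is_cring)
    show "abelian_group N"
    proof (rule abelian_groupI)
      fix x assume "x \<in> carrier N"
      then obtain a where a: "a \<in> carrier M" "x = f a" by (auto simp: carrier)
      show "\<exists>y\<in>carrier N. y \<oplus>\<^bsub>N\<^esub> x = \<zero>\<^bsub>N\<^esub>"
        by (rule bexI[of _ "f (\<ominus>\<^bsub>M\<^esub> a)"]) (simp_all add: a carrier zero lin M.l_neg)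
    qed (auto simp: carrier zero lin M.a_ac)
  qed (auto simp: carrier lin M.smult_l_distr M.smult_r_distr M.smult_assoc1)
qed

context quasi_bialgebra
begin

text \<open>Every element of \<open>A'\<close> is an image f(a), so each axiom is the image of an
  axiom of \<open>A\<close>. In the two axioms with Sweedler sums, f passes through the sum by
  linearity; this yields quasi-associativity of * without a calculation in A # H.\<close>

lemma left_module_algebra_transport:
  assumes A: "left_module_algebra K H A" and f: "f \<in> lin_hom K A A'"
    and carrier: "carrier A' = f ` carrier A" and zero: "\<zero>\<^bsub>A'\<^esub> = f \<zero>\<^bsub>A\<^esub>" and one: "\<one>\<^bsub>A'\<^esub> = f \<one>\<^bsub>A\<^esub>"
    and mult: "\<And>a b. a \<in> carrier A \<Longrightarrow> b \<in> carrier A \<Longrightarrow> f a \<otimes>\<^bsub>A'\<^esub> f b = f (a \<otimes>\<^bsub>A\<^esub> b)"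
    and act: "\<And>h a. h \<in> carrier H \<Longrightarrow> a \<in> carrier A \<Longrightarrow> h \<cdot>\<^bsub>A'\<^esub> f a = f (h \<cdot>\<^bsub>A\<^esub> a)"
  shows "left_module_algebra K H A'"
proof -
  interpret A: left_module_algebra K H A by fact
  have mA [simp]: "module K A" by (rule A.module_axioms)
  have mA' [simp]: "module K A'" by (rule module_transport[OF mA f carrier zero])
  note lin = lin_hom_add[OF f, symmetric] lin_hom_smult[OF f, symmetric]
  note cl [simp] = A.act_closed A.mult_closed A.unit_closed
  have cf [simp]: "a \<in> carrier A \<Longrightarrow> f a \<in> carrier A'" for a by (simp add: carrier)
  have bact: "bilin K H A A (act A)"
    by (intro bilinI lin_homI) (simp_all add: A.act_add_left A.act_add_right A.act_smult_left A.act_smult_right)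
  have bmult: "bilin K A A A (mult A)"
    by (intro bilinI lin_homI) (simp_all add: A.mult_add_left A.mult_add_right A.mult_smult_left A.mult_smult_right)
  have bact': "bilin K H A' A' (act A')"
    by (intro bilinI lin_homI)
      (auto simp: carrier act lin A.act_add_left A.act_add_right A.act_smult_left A.act_smult_right)
  have bmult': "bilin K A' A' A' (mult A')"
    by (intro bilinI lin_homI)
      (auto simp: carrier mult lin A.mult_add_left A.mult_add_right A.mult_smult_left A.mult_smult_right)
  note b [simp] = bilin_left[OF bact] bilin_right[OF bact] bilin_left[OF bmult] bilin_right[OF bmult]
    bilin_left[OF bact'] bilin_right[OF bact'] bilin_left[OF bmult'] bilin_right[OF bmult']
    lin_hom_compose[OF f] bilin_closed[OF bact'] bilin_closed[OF bmult']
  show ?thesis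
  proof (intro left_module_algebra.intro left_module_algebra_axioms.intro mA')
    fix a a' a'' assume "a \<in> carrier A'" "a' \<in> carrier A'" "a'' \<in> carrier A'"
    then obtain x y z where [simp]: "x \<in> carrier A" "y \<in> carrier A" "z \<in> carrier A"
      and eq: "a = f x" "a' = f y" "a'' = f z" by (auto simp: carrier)
    have "f (tsum3 K A (reassoc H) (\<lambda>X1 X2 X3. (X1 \<cdot>\<^bsub>A\<^esub> x) \<otimes>\<^bsub>A\<^esub> ((X2 \<cdot>\<^bsub>A\<^esub> y) \<otimes>\<^bsub>A\<^esub> (X3 \<cdot>\<^bsub>A\<^esub> z))))
      = tsum3 K A' (reassoc H) (\<lambda>X1 X2 X3. (X1 \<cdot>\<^bsub>A'\<^esub> f x) \<otimes>\<^bsub>A'\<^esub> ((X2 \<cdot>\<^bsub>A'\<^esub> f y) \<otimes>\<^bsub>A'\<^esub> (X3 \<cdot>\<^bsub>A'\<^esub> f z)))"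
      by (rule ext3[where P = A']) (simp_all add: act mult)
    thus "a \<otimes>\<^bsub>A'\<^esub> a' \<otimes>\<^bsub>A'\<^esub> a'' = tsum3 K A' (reassoc H) (\<lambda>X1 X2 X3.
        (X1 \<cdot>\<^bsub>A'\<^esub> a) \<otimes>\<^bsub>A'\<^esub> ((X2 \<cdot>\<^bsub>A'\<^esub> a') \<otimes>\<^bsub>A'\<^esub> (X3 \<cdot>\<^bsub>A'\<^esub> a'')))"
      by (simp add: eq mult A.mult_quasi_assoc del: tsum3_def)
  next
    fix h a a' assume h [simp]: "h \<in> carrier H" and "a \<in> carrier A'" "a' \<in> carrier A'"
    then obtain x y where [simp]: "x \<in> carrier A" "y \<in> carrier A"
      and eq: "a = f x" "a' = f y" by (auto simp: carrier)
    have "f (tsum K A (comul H h) (\<lambda>h1 h2. (h1 \<cdot>\<^bsub>A\<^esub> x) \<otimes>\<^bsub>A\<^esub> (h2 \<cdot>\<^bsub>A\<^esub> y)))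
      = tsum K A' (comul H h) (\<lambda>h1 h2. (h1 \<cdot>\<^bsub>A'\<^esub> f x) \<otimes>\<^bsub>A'\<^esub> (h2 \<cdot>\<^bsub>A'\<^esub> f y))"
      by (rule tsum_push[OF f]) (simp_all add: act mult)
    thus "h \<cdot>\<^bsub>A'\<^esub> (a \<otimes>\<^bsub>A'\<^esub> a') = tsum K A' (comul H h) (\<lambda>h1 h2. (h1 \<cdot>\<^bsub>A'\<^esub> a) \<otimes>\<^bsub>A'\<^esub> (h2 \<cdot>\<^bsub>A'\<^esub> a'))"
      by (simp add: eq mult act A.act_on_mult)
  qed (auto simp: quasi_bialgebra_axioms carrier act mult one lin A.act_add_left A.act_add_right
      A.act_smult_left A.act_smult_right A.act_mult A.act_one A.mult_add_left A.mult_add_right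
      A.mult_smult_left A.mult_smult_right A.unit_left A.unit_right A.act_on_one)
qed

end

section \<open>Product and action on the coinvariants, and the isomorphism with A\<close>

context smash_setting
begin

text \<open>E replaces the H-component x^3 of the product by \<epsilon>(x^3), and \<Phi>\<inverse>
  with \<epsilon> in its third slot is trivial by \<open>eps_reassoc_inv\<close>.\<close>

lemma smash_E_mult:
  assumes [simp]: "a \<in> carrier A" "a' \<in> carrier A"
  shows "E (sm a \<one> \<otimes>\<^bsub>B\<^esub> sm a' \<one>) = sm (a \<otimes>\<^bsub>A\<^esub> a') \<one>"
proof -
  let ?F = "\<lambda>x y z. counit H z \<odot>\<^bsub>TB\<^esub> sm ((x \<cdot>\<^bsub>A\<^esub> a) \<otimes>\<^bsub>A\<^esub> (y \<cdot>\<^bsub>A\<^esub> a')) \<one>"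
  have "E (sm a \<one> \<otimes>\<^bsub>B\<^esub> sm a' \<one>) = tsum3 K TB (eps3 (reassoc_inv K H)) ?F"
    unfolding smash_mult_pure[OF assms(1) one_closed assms(2) one_closed]
    by (rule ext3[where P = TB and t = "reassoc_inv K H" and g = "\<lambda>t. tsum3 K TB (eps3 t) ?F"])
      (simp_all add: lin_hom_compose[OF smash_E_linear] smash_E_pure)
  thus ?thesis by (simp add: eps_reassoc_inv)
qed

lemma smash_E_act:
  assumes [simp]: "h \<in> carrier H" "a \<in> carrier A"
  shows "E (j h \<otimes>\<^bsub>B\<^esub> sm a \<one>) = sm (h \<cdot>\<^bsub>A\<^esub> a) \<one>"
proof -
  have "E (j h \<otimes>\<^bsub>B\<^esub> sm a \<one>)
      = tsum K TB (comul H h) (\<lambda>h1 h2. counit H h2 \<odot>\<^bsub>TB\<^esub> sm (h1 \<cdot>\<^bsub>A\<^esub> a) \<one>)"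
    unfolding j_mult[OF assms one_closed]
    by (rule tsum_push[OF smash_E_linear]) (simp_all add: smash_E_pure)
  also have "\<dots> = sm (h \<cdot>\<^bsub>A\<^esub> a) \<one>" by (rule tsum_counit_right) simp_all
  finally show ?thesis .
qed

text \<open>The map id \<otimes> \<epsilon> from A # H to A. It describes E on all of A # H and is a
  left inverse of a |-> a # 1, which gives both the image of E and injectivity.\<close>

definition "eps_right b = tsum K A b (\<lambda>a h. counit H h \<odot>\<^bsub>A\<^esub> a)"

lemma eps_right_lin: "eps_right \<in> lin_hom K TB A"
  unfolding eps_right_def[abs_def] by simp

lemma eps_right_pure [simp]:
  "a \<in> carrier A \<Longrightarrow> h \<in> carrier H \<Longrightarrow> eps_right (sm a h) = counit H h \<odot>\<^bsub>A\<^esub> a"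
  unfolding eps_right_def by simp

lemma smash_E_eps_right:
  assumes "b \<in> carrier TB" shows "E b = sm (eps_right b) \<one>"
  by (rule lin_hom_tensor_eqI[of K A H, OF _ _ _ _ _ _ assms, where P = TB])
    (simp_all add: smash_E_linear lin_hom_compose[OF eps_right_lin] smash_E_pure)

lemma smash_E_image: "E ` carrier TB = (\<lambda>a. sm a \<one>) ` carrier A"
proof
  show "E ` carrier TB \<subseteq> (\<lambda>a. sm a \<one>) ` carrier A"
    using lin_hom_closed[OF eps_right_lin] by (auto simp: smash_E_eps_right)
  have "sm a \<one> \<in> E ` carrier TB" if "a \<in> carrier A" for a
    using that by (intro image_eqI[of _ _ "sm a \<one>"]) (simp_all add: smash_E_pure)
  thus "(\<lambda>a. sm a \<one>) ` carrier A \<subseteq> E ` carrier TB" by auto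
qed

lemma smash_one_inj: "inj_on (\<lambda>a. sm a \<one>) (carrier A)"
proof (rule inj_on_inverseI)
  fix a assume "a \<in> carrier A"
  thus "eps_right (sm a \<one>) = a" by simp
qed

lemma smash_coinv_simps:
  "carrier (smash_coinv K H A) = (\<lambda>a. sm a \<one>) ` carrier A"
  "mult (smash_coinv K H A) = (\<lambda>b b'. E (b \<otimes>\<^bsub>B\<^esub> b'))"
  "one (smash_coinv K H A) = sm \<one>\<^bsub>A\<^esub> \<one>"
  "zero (smash_coinv K H A) = \<zero>\<^bsub>TB\<^esub>"
  "add (smash_coinv K H A) = add TB"
  "smult (smash_coinv K H A) = smult TB"
  "act (smash_coinv K H A) = (\<lambda>h b. E (j h \<otimes>\<^bsub>B\<^esub> b))"
  by (simp_all add: smash_coinv_def Let_def smash_E_image) (simp add: smash_def)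

lemma smash_coinv_lin: "(\<lambda>a. sm a \<one>) \<in> lin_hom K A (smash_coinv K H A)"
  using lin_homD[of "\<lambda>a. sm a \<one>" K A TB]
  by (intro lin_homI) (simp_all add: smash_coinv_simps)

lemma smash_coinv_module_algebra: "left_module_algebra K H (smash_coinv K H A)"
proof (rule left_module_algebra_transport[OF A.left_module_algebra_axioms smash_coinv_lin])
  have "(\<lambda>a. sm a \<one>) \<in> lin_hom K A TB" by simp
  from lin_hom_zero[OF this] show "\<zero>\<^bsub>smash_coinv K H A\<^esub> = sm \<zero>\<^bsub>A\<^esub> \<one>"
    by (simp add: smash_coinv_simps)
qed (simp_all add: smash_coinv_simps smash_E_mult smash_E_act)

lemma smash_coinv_iso: "(\<lambda>a. sm a \<one>) \<in> module_algebra_iso K H A (smash_coinv K H A)"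
  using smash_coinv_lin smash_one_inj
  by (simp add: module_algebra_iso_def module_algebra_hom_def bij_betw_def smash_coinv_simps
      smash_E_mult smash_E_act)

end

theorem mainTheorem2:
  fixes K :: "('k, 'm) ring_scheme"
    and H :: "('k, 'h, 'p) quasi_hopf_scheme"
    and A :: "('k, 'h, 'a, 'q) module_algebra_scheme"
  assumes "quasi_hopf_algebra K H"
    and "left_module_algebra K H A"
  shows "let B = smash K H A; E = smash_E K H A; BcoH = smash_coinv K H A; sm = tpure K A H in
    (\<forall>a \<in> carrier A. \<forall>h \<in> carrier H. E (sm a h) = counit H h \<odot>\<^bsub>B\<^esub> sm a \<one>\<^bsub>H\<^esub>) \<and>
    carrier BcoH = {sm a \<one>\<^bsub>H\<^esub> | a. a \<in> carrier A} \<and>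
    (\<forall>a \<in> carrier A. \<forall>a' \<in> carrier A.
      sm a \<one>\<^bsub>H\<^esub> \<otimes>\<^bsub>BcoH\<^esub> sm a' \<one>\<^bsub>H\<^esub> = sm (a \<otimes>\<^bsub>A\<^esub> a') \<one>\<^bsub>H\<^esub>) \<and>
    (\<forall>h \<in> carrier H. \<forall>a \<in> carrier A.
      h \<cdot>\<^bsub>BcoH\<^esub> sm a \<one>\<^bsub>H\<^esub> = sm (h \<cdot>\<^bsub>A\<^esub> a) \<one>\<^bsub>H\<^esub>) \<and>
    left_module_algebra K H BcoH \<and>
    (\<lambda>a. sm a \<one>\<^bsub>H\<^esub>) \<in> module_algebra_iso K H A BcoH"
proof -
  interpret smash_setting K H A
    using assms by (rule smash_setting.intro)
  show ?thesis
    using smash_coinv_module_algebra smash_coinv_iso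
    by (simp add: Let_def smash_E_pure smash_coinv_simps smash_E_mult smash_E_act) blast
qed

end
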